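(* Let $1\le k\le n-1$, let $\mathcal{M}$ consist of the graphs $M_\phi$ of $\phi=(\phi_i)_{i=1}^{n-k}:[-1,1]^k\to\mathbb{R}^{n-k}$ with polynomials $\phi_i\in\mathcal{P}_{k,d}$, and let $\mathfrak{R}=\{\mathcal{R}\}$ for some $\mathcal{R}\subseteq\mathcal{R}_0$. Let $H:\mathcal{M}\to\mathcal{P}^0_{k,D}$ be a mapping such that the coefficients of $HM_\phi$ are polynomial functions of the coefficients of $\phi$, and which obeys the following property: if $HM_\phi\equiv0$ and $c\in\mathbb{R}$, then $HM_{c\phi}\equiv0$. Then $H$ is a degeneracy determinant on $\mathcal{M}$, with the constants $C,C',\beta$ depending only on $H$.
   Context: $\mathcal{P}^0_{k,d}$ is the set of all $k$-variate real polynomials of degree at most $d$; $\mathcal{P}_{k,d}$ is the subset of those $\phi$ with $\sup_{[-1,1]^k}|\phi|\le1$. $\mathcal{R}_0$ is the collection of all parallelograms contained in $[-1,1]^k$ with positive $k$-volume, a parallelogram being a set $\{x+b:|x\cdot u_i|\le l_i\}$ with $\{u_i\}$ a basis of $\mathbb{R}^k$ consisting of unit vectors. Since the coefficients of $HM_\phi$ are given by polynomials in the coefficients of $\phi$, $H$ extends naturally to all $\phi\in(\mathcal{P}^0_{k,d})^{n-k}$; $HM_{c\phi}$ is understood through this extension. An operator $H$ mapping each $M_\phi\in\mathcal{M}$ to a smooth function on $[-1,1]^k$ is a degeneracy determinant on $\mathcal{M}$, with constants $C,C'\ge1$ and $\beta\in(0,1]$, if: (1) (Lipschitz) for every $M_\phi\in\mathcal{M}$,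 $|HM_\phi(x)-HM_\phi(y)|\le C|x-y|$ for all $x,y\in[-1,1]^k$; (2) (totally degenerate approximation) whenever $M_\phi\in\mathcal{M}$ satisfies $|HM_\phi(x)|\le\sigma$ on $[-1,1]^k$ for some $\sigma\in(0,1]$, there exists $M_\psi\in\mathcal{M}$ with $HM_\psi\equiv0$ on $[-1,1]^k$ and $\|\phi-C'\psi\|_{L^\infty([-1,1]^k)}\le C\sigma^\beta$.
   Formalization: Added hypothesis: if some M_φ in the class has |HM_φ| ≤ 1 on the cube, then some M_ψ in the class has HM_ψ ≡ 0. Without it the claim fails, e.g. for HM_φ ≡ 1/2, where condition (2) at σ = 1/2 has no ψ; the conclusion itself implies it. *)

theory Defs
  imports
    "HOL-Analysis.Analysis"
    "HOL-Probability.Essential_Supremum"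
    "HOL-Library.Poly_Mapping"
begin

text \<open>
  Throughout, \<open>k = CARD('k)\<close> and \<open>n - k = CARD('m)\<close>, so that \<open>1 \<le> k \<le> n - 1\<close> holds because
  types are nonempty.
\<close>

subsection \<open>Real polynomials in several variables\<close>

text \<open>A polynomial is the finitely supported map from exponent vectors to coefficients.\<close>

type_synonym 'v real_mpoly = "('v \<Rightarrow>\<^sub>0 nat) \<Rightarrow>\<^sub>0 real"

definition mpoly_eval :: "'v real_mpoly \<Rightarrow> ('v \<Rightarrow> real) \<Rightarrow> real" where
  "mpoly_eval p a =
     (\<Sum>e\<in>Poly_Mapping.keys p. Poly_Mapping.lookup p e *
        (\<Prod>v\<in>Poly_Mapping.keys e. a v ^ Poly_Mapping.lookup e v))"

definition mpoly_fun :: "'k::finite real_mpoly \<Rightarrow> real ^ 'k \<Rightarrow> real" where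
  "mpoly_fun p x = mpoly_eval p (\<lambda>i. x $ i)"

definition cube :: "(real ^ 'k::finite) set" where
  "cube = cbox (- 1) 1"

definition polys0 :: "nat \<Rightarrow> 'k::finite real_mpoly set" where
  "polys0 d = {p. \<forall>e\<in>Poly_Mapping.keys p. (\<Sum>i\<in>UNIV. Poly_Mapping.lookup e i) \<le> d}"

definition polys :: "nat \<Rightarrow> 'k::finite real_mpoly set" where
  "polys d = {p \<in> polys0 d. (SUP x\<in>cube. \<bar>mpoly_fun p x\<bar>) \<le> 1}"

definition mpoly_map :: "('m::finite \<Rightarrow> 'k::finite real_mpoly) \<Rightarrow> real ^ 'k \<Rightarrow> real ^ 'm" where
  "mpoly_map \<phi> x = (\<chi> i. mpoly_fun (\<phi> i) x)"

definition mpoly_scale :: "real \<Rightarrow> ('m \<Rightarrow> 'k real_mpoly) \<Rightarrow> 'm \<Rightarrow> 'k real_mpoly" where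
  "mpoly_scale c \<phi> i = Poly_Mapping.map (\<lambda>a. c * a) (\<phi> i)"


subsection \<open>Parallelograms\<close>

definition parallelogram :: "(real ^ 'k::finite) set \<Rightarrow> bool" where
  "parallelogram P \<longleftrightarrow>
     (\<exists>(u :: 'k \<Rightarrow> real ^ 'k) (l :: 'k \<Rightarrow> real) b.
        inj u \<and> independent (u ` UNIV) \<and> span (u ` UNIV) = UNIV \<and> (\<forall>i. norm (u i) = 1) \<and>
        P = {x + b | x. \<forall>i. \<bar>x \<bullet> u i\<bar> \<le> l i})"

definition parallelograms0 :: "(real ^ 'k::finite) set set" where
  "parallelograms0 = {P. parallelogram P \<and> P \<subseteq> cube \<and> 0 < emeasure lebesgue P}"


subsection \<open>Graphs and degeneracy determinants\<close>

text \<open>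
  Functions on the cube are represented by total functions whose values off the cube are
  irrelevant; a graph only sees the values on the cube.
\<close>

definition graph_of :: "(real ^ 'k::finite \<Rightarrow> real ^ 'm::finite) \<Rightarrow> ((real ^ 'k) \<times> (real ^ 'm)) set" where
  "graph_of \<phi> = {(x, \<phi> x) | x. x \<in> cube}"

definition poly_graphs :: "nat \<Rightarrow> ((real ^ 'k::finite) \<times> (real ^ 'm::finite)) set set" where
  "poly_graphs d = {graph_of (mpoly_map \<phi>) | \<phi>. \<forall>i. \<phi> i \<in> polys d}"

text \<open>
  All iterated partial derivatives exist on the closed set (one-sided at its boundary);
  \<open>F is\<close> is the partial derivative of \<open>f\<close> along the list of directions \<open>is\<close>.
\<close>

definition smooth_on_cube :: "(real ^ 'k::finite \<Rightarrow> real) \<Rightarrow> bool" where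
  "smooth_on_cube f \<longleftrightarrow>
     (\<exists>F :: 'k list \<Rightarrow> real ^ 'k \<Rightarrow> real.
        (\<forall>x\<in>cube. F [] x = f x) \<and>
        (\<forall>is. \<forall>x\<in>cube.
           (F is has_derivative (\<lambda>h. \<Sum>i\<in>UNIV. F (i # is) x * h $ i)) (at x within cube)))"

definition Linf_norm_cube :: "(real ^ 'k::finite \<Rightarrow> real ^ 'm::finite) \<Rightarrow> ereal" where
  "Linf_norm_cube f = esssup (lebesgue_on cube) (\<lambda>x. ereal (norm (f x)))"

definition degeneracy_determinant ::
  "((real ^ 'k::finite) \<times> (real ^ 'm::finite)) set set \<Rightarrow>
   (((real ^ 'k) \<times> (real ^ 'm)) set \<Rightarrow> real ^ 'k \<Rightarrow> real) \<Rightarrow> real \<Rightarrow> real \<Rightarrow> real \<Rightarrow> bool" where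
  "degeneracy_determinant \<M> H C C' \<beta> \<longleftrightarrow>
     C \<ge> 1 \<and> C' \<ge> 1 \<and> 0 < \<beta> \<and> \<beta> \<le> 1 \<and>
     (\<forall>M\<in>\<M>. smooth_on_cube (H M)) \<and>
     (\<forall>M\<in>\<M>. \<forall>x\<in>cube. \<forall>y\<in>cube. \<bar>H M x - H M y\<bar> \<le> C * norm (x - y)) \<and>
     (\<forall>\<phi> \<sigma>. graph_of \<phi> \<in> \<M> \<longrightarrow> 0 < \<sigma> \<longrightarrow> \<sigma> \<le> 1 \<longrightarrow> (\<forall>x\<in>cube. \<bar>H (graph_of \<phi>) x\<bar> \<le> \<sigma>) \<longrightarrow>
        (\<exists>\<psi>. graph_of \<psi> \<in> \<M> \<and> (\<forall>x\<in>cube. H (graph_of \<psi>) x = 0) \<and>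
             Linf_norm_cube (\<lambda>x. \<phi> x - C' *\<^sub>R \<psi> x) \<le> ereal (C * \<sigma> powr \<beta>)))"

text \<open>
  The coefficients of \<open>H M\<^sub>\<phi>\<close> are polynomial functions of the coefficients of \<open>\<phi>\<close>, and \<open>E\<close> is the
  resulting extension of \<open>H\<close> to all tuples of polynomials of degree at most \<open>d\<close>. The variables of
  the polynomials \<open>q\<close> are pairs of a component index and an exponent vector. On such tuples, \<open>E\<close> is
  determined by \<open>H\<close>, because the coefficient vectors of tuples in \<open>polys d\<close> have nonempty
  interior.
\<close>

definition polynomial_extension ::
  "nat \<Rightarrow> nat \<Rightarrow> (((real ^ 'k::finite) \<times> (real ^ 'm::finite)) set \<Rightarrow> 'k real_mpoly) \<Rightarrow>
   (('m \<Rightarrow> 'k real_mpoly) \<Rightarrow> 'k real_mpoly) \<Rightarrow> bool" where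
  "polynomial_extension d D H E \<longleftrightarrow>
     (\<forall>\<phi>. (\<forall>i. \<phi> i \<in> polys d) \<longrightarrow> H (graph_of (mpoly_map \<phi>)) = E \<phi>) \<and>
     (\<forall>\<phi>. (\<forall>i. \<phi> i \<in> polys0 d) \<longrightarrow> E \<phi> \<in> polys0 D) \<and>
     (\<forall>e. \<exists>q :: ('m \<times> ('k \<Rightarrow>\<^sub>0 nat)) real_mpoly. \<forall>\<phi>. (\<forall>i. \<phi> i \<in> polys0 d) \<longrightarrow>
        Poly_Mapping.lookup (E \<phi>) e = mpoly_eval q (\<lambda>(i, e'). Poly_Mapping.lookup (\<phi> i) e'))"

end

theory Submission
  imports Defs
begin

text \<open>
  Take \<open>C' = 1\<close> and identify a tuple \<open>\<phi>\<close> with its coefficient vector. The set of pairs \<open>(t, s)\<close> such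
  that some normalised \<open>\<phi>\<close> has determinant at most \<open>s\<close> but distance more than \<open>t\<close> from all normalised
  degenerate tuples is semialgebraic, by quantifier elimination. By compactness, for each \<open>t > 0\<close> it
  contains no point \<open>(t, s)\<close> with \<open>s > 0\<close> small. A semialgebraic subset of the plane with this property
  avoids a region \<open>0 < s < c t\<^sup>l\<close>, which is the approximation property with \<open>\<beta> = 1 / l\<close>. Normalisation
  is itself a semialgebraic condition, which is why \<open>C' = 1\<close> suffices. The Lipschitz bound holds since the coefficients of normalised tuples are bounded.
\<close>

text \<open>The approximation property is an inequality of Lojasiewicz type, but the approximating
  tuple must be normalised as well as degenerate, so the target is cut out by sup norm bounds
  besides equations. The inequality for zero sets of polynomials does not apply directly, whereas a
  first-order description of failure takes in all conditions at once. It has only two free real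
  variables, and in the plane orders of vanishing of polynomials in one variable are enough.

  Quantifier elimination is used in a weak form: finitely many polynomials decide the truth value by
  their signs, and no formula is constructed. Its core lies on the line: if enough derived
  coefficients agree in sign at two parameters, the two specialised families differ by an increasing
  bijection that preserves all signs.

  The exponent \<beta> comes from small t only. For t bounded below, a single degenerate tuple
  suffices, as two normalised tuples differ by at most 2 in each component. The hypothesis
  \<open>zero\<close> supplies this tuple whenever condition (2) is not vacuous.\<close>

inductive_set polyfuns :: "(('v \<Rightarrow> real) \<Rightarrow> real) set" where
  polyfuns_const: "(\<lambda>x. c) \<in> polyfuns"
| polyfuns_var: "(\<lambda>x. x v) \<in> polyfuns"
| polyfuns_add: "f \<in> polyfuns \<Longrightarrow> g \<in> polyfuns \<Longrightarrow> (\<lambda>x. f x + g x) \<in> polyfuns"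
| polyfuns_mult: "f \<in> polyfuns \<Longrightarrow> g \<in> polyfuns \<Longrightarrow> (\<lambda>x. f x * g x) \<in> polyfuns"

lemma polyfuns_diff: "f \<in> polyfuns \<Longrightarrow> g \<in> polyfuns \<Longrightarrow> (\<lambda>x. f x - g x) \<in> polyfuns"
  using polyfuns_add[OF _ polyfuns_mult[OF polyfuns_const[of "-1"]], of f g] by simp

lemma polyfuns_power: "f \<in> polyfuns \<Longrightarrow> (\<lambda>x. f x ^ n) \<in> polyfuns"
  by (induction n) (auto intro: polyfuns_const polyfuns_mult)

lemma polyfuns_sum: "(\<And>i. i \<in> I \<Longrightarrow> f i \<in> polyfuns) \<Longrightarrow> (\<lambda>x. \<Sum>i\<in>I. f i x) \<in> polyfuns"
  by (induction I rule: infinite_finite_induct) (auto intro: polyfuns_const polyfuns_add)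

lemma polyfuns_prod: "(\<And>i. i \<in> I \<Longrightarrow> f i \<in> polyfuns) \<Longrightarrow> (\<lambda>x. \<Prod>i\<in>I. f i x) \<in> polyfuns"
  by (induction I rule: infinite_finite_induct) (auto intro: polyfuns_const polyfuns_mult)

subsection \<open>Sign diagrams of families of real polynomials\<close>

text \<open>Interpolation: beyond the previous largest point \<open>M\<close> the map is replaced by
  an affine half-line of positive slope through the next prescribed value, which also preserves
  surjectivity. It turns an order preserving matching of finitely many roots into a
  reparametrisation of the line.\<close>

lemma strict_mono_on_extend:
  fixes k :: "real \<Rightarrow> real"
  assumes "finite S" "strict_mono_on S k"
  shows "\<exists>h. strict_mono h \<and> surj h \<and> (\<forall>s\<in>S. h s = k s)"
  using assms
proof (induction S rule: finite_linorder_max_induct)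
  case empty
  show ?case by (rule exI[of _ "\<lambda>x. x"]) (auto simp: strict_mono_def)
next
  case (insert m S)
  then obtain h where h: "strict_mono h" "surj h" "\<And>s. s \<in> S \<Longrightarrow> h s = k s"
    by (auto simp: strict_mono_on_def)
  show ?case
  proof (cases "S = {}")
    case True
    have "strict_mono (\<lambda>t. t + (k m - m))" "surj (\<lambda>t. t + (k m - m))"
      by (auto simp: strict_mono_def intro: surjI[of _ "\<lambda>t. t - (k m - m)"])
    then show ?thesis using True by (intro exI[of _ "\<lambda>t. t + (k m - m)"]) auto
  next
    case False
    define M where "M = Max S"
    have M: "M \<in> S" "\<And>s. s \<in> S \<Longrightarrow> s \<le> M" using False insert.hyps by (auto simp: M_def)
    have Mm: "M < m" using M insert.hyps by auto
    have kM: "k M < k m" using insert.prems M Mm by (auto simp: strict_mono_on_def)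
    define c where "c = (k m - k M) / (m - M)"
    have c: "c > 0" using Mm kM by (auto simp: c_def)
    define g where "g t = (if t \<le> M then h t else k M + (t - M) * c)" for t
    have "g s < g t" if "s < t" for s t
    proof (cases "s \<le> M \<and> \<not> t \<le> M")
      case True
      have "h s \<le> k M" using True h(1) h(3)[OF M(1)] by (metis strict_mono_less_eq)
      moreover have "0 < (t - M) * c" using True c by auto
      ultimately show ?thesis using True by (auto simp: g_def)
    next
      case False
      then show ?thesis using that h(1) c by (auto simp: g_def strict_mono_def)
    qed
    then have "strict_mono g" by (auto simp: strict_mono_def)
    moreover have "\<exists>t. y = g t" for y
    proof (cases "y \<le> k M")
      case True
      obtain t where "y = h t" using h(2) by (metis surj_def)
      then show ?thesis using True h(1) h(3)[OF M(1)]
        by (intro exI[of _ t]) (metis g_def strict_mono_less_eq)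
    next
      case False
      then have "M + (y - k M) / c > M" using c by auto
      then show ?thesis using c by (intro exI[of _ "M + (y - k M) / c"]) (auto simp: g_def)
    qed
    then have "surj g" by (auto simp: surj_def)
    moreover have "g m = k m" using Mm by (auto simp: g_def c_def)
    moreover have "\<forall>s\<in>S. g s = k s" using h(3) M by (auto simp: g_def)
    ultimately show ?thesis by auto
  qed
qed

lemma sgn_poly_eq_if_no_root:
  fixes p :: "real poly"
  assumes "a \<le> b" "\<And>x. a \<le> x \<Longrightarrow> x \<le> b \<Longrightarrow> poly p x \<noteq> 0"
  shows "sgn (poly p a) = sgn (poly p b)"
proof (rule ccontr)
  assume ne: "sgn (poly p a) \<noteq> sgn (poly p b)"
  have "poly p a \<noteq> 0" "poly p b \<noteq> 0" using assms by auto
  then have "a < b" "poly p a * poly p b < 0"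
    using ne assms(1) by (cases "a = b"; auto simp: sgn_if mult_less_0_iff split: if_splits)+
  then obtain x where "a < x" "x < b" "poly p x = 0" using poly_IVT by blast
  then show False using assms by auto
qed

text \<open>A derivative without zeros makes \<open>p\<close> strictly monotone, so \<open>p\<close>
  at \<open>t\<close> lies strictly between two end values that are not of opposite sign. The
  formula involves only the signs at the ends, so it can be transported from one polynomial to
  another.\<close>

lemma sgn_poly_between:
  fixes p :: "real poly"
  assumes "a < t" "t < b" and nz: "\<And>x. a < x \<Longrightarrow> x < b \<Longrightarrow> poly (pderiv p) x \<noteq> 0"
    and ends: "poly p a * poly p b \<ge> 0"
  shows "sgn (poly p t) = sgn (sgn (poly p a) + sgn (poly p b))"
proof -
  obtain c where c: "a < c" "c < t" "poly p t - poly p a = (t - a) * poly (pderiv p) c"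
    using poly_MVT[OF assms(1)] by metis
  obtain e where e: "t < e" "e < b" "poly p b - poly p t = (b - t) * poly (pderiv p) e"
    using poly_MVT[OF assms(2)] by metis
  have "sgn (poly (pderiv p) c) = sgn (poly (pderiv p) e)"
    using c e nz by (intro sgn_poly_eq_if_no_root) auto
  moreover have "poly (pderiv p) c \<noteq> 0" using c e nz by auto
  ultimately have "(poly p a < poly p t \<and> poly p t < poly p b) \<or> (poly p a > poly p t \<and> poly p t > poly p b)"
    using c(3) e(3) assms(1,2)
    by (smt (verit, ccfv_threshold) mult_neg_neg mult_pos_pos mult_pos_neg sgn_if)
  then show ?thesis using ends
    by (smt (verit, ccfv_threshold) sgn_if mult_neg_pos mult_pos_neg)
qed

lemma sgn_poly_at_top:
  fixes p :: "real poly"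
  shows "\<exists>U. \<forall>t\<ge>U. sgn (poly p t) = sgn (lead_coeff p)"
proof (cases "lead_coeff p = 0")
  case False
  show ?thesis
  proof (cases "lead_coeff p > 0")
    case True
    then show ?thesis using poly_pinfty_gt_lc[of p] by (metis less_le_trans sgn_pos)
  next
    case f: False
    then have "lead_coeff (- p) > 0" using False by (simp add: not_less less_le)
    then obtain U where U: "\<And>t. t \<ge> U \<Longrightarrow> poly (- p) t \<ge> lead_coeff (- p)"
      using poly_pinfty_gt_lc by metis
    have "poly p t < 0" if "t \<ge> U" for t using U[OF that] \<open>lead_coeff (- p) > 0\<close> by simp
    moreover have "lead_coeff p < 0" using f False less_linear by blast
    ultimately show ?thesis by (intro exI[of _ U]) auto
  qed
qed auto

lemma sgn_poly_at_bot:
  fixes p :: "real poly"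
  shows "\<exists>L. \<forall>t\<le>L. sgn (poly p t) = (-1) ^ degree p * sgn (lead_coeff p)"
proof -
  define q where "q = pcompose p [:0, -1:]"
  obtain U where U: "\<And>t. t \<ge> U \<Longrightarrow> sgn (poly q t) = sgn (lead_coeff q)"
    using sgn_poly_at_top by metis
  have "lead_coeff q = lead_coeff p * (-1) ^ degree p"
    unfolding q_def by (subst lead_coeff_comp) auto
  moreover have "sgn (poly p t) = sgn (poly q (- t))" for t by (simp add: q_def poly_pcompose)
  ultimately show ?thesis
    by (intro exI[of _ "-U"]) (auto simp: U sgn_mult power_sgn mult.commute)
qed

lemma poly_root_sign_change:
  fixes p :: "real poly"
  assumes "a < t" "t < b" and nz: "\<And>x. a < x \<Longrightarrow> x < b \<Longrightarrow> poly (pderiv p) x \<noteq> 0"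
    and "poly p t = 0"
  shows "poly p a * poly p b < 0"
proof (rule ccontr)
  assume n: "\<not> ?thesis"
  then have "sgn (sgn (poly p a) + sgn (poly p b)) = 0"
    using sgn_poly_between[of a t b p] assms by auto
  then have "poly p a = 0" using n
    by (auto simp: sgn_if mult_less_0_iff split: if_splits)
  then show False using poly_MVT[OF assms(1), of p] assms by auto
qed

lemma finite_neighbours:
  fixes S :: "real set"
  assumes "finite S" "c \<in> S" "c < t" "d \<in> S" "t < d"
  obtains a b where "a \<in> S" "b \<in> S" "a < t" "t < b" "\<And>c. c \<in> S \<Longrightarrow> c \<le> a \<or> c = t \<or> b \<le> c"
proof
  have "finite {c\<in>S. c < t}" "{c\<in>S. c < t} \<noteq> {}" "finite {c\<in>S. t < c}" "{c\<in>S. t < c} \<noteq> {}"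
    using assms by auto
  from Max_in[OF this(1,2)] Min_in[OF this(3,4)] Max_ge[OF this(1)] Min_le[OF this(3)]
  show "Max {c\<in>S. c < t} \<in> S" "Min {c\<in>S. t < c} \<in> S" "Max {c\<in>S. c < t} < t" "t < Min {c\<in>S. t < c}"
    "\<And>c. c \<in> S \<Longrightarrow> c \<le> Max {c\<in>S. c < t} \<or> c = t \<or> Min {c\<in>S. t < c} \<le> c"
    by auto (metis linorder_neqE_linordered_idom)
qed

lemma mult_neg_cong_sgn:
  fixes a b c d :: real
  assumes "sgn a = sgn b" "sgn c = sgn d"
  shows "a * c < 0 \<longleftrightarrow> b * d < 0"
  using assms by (metis sgn_mult sgn_less)

text \<open>Monotonicity and surjectivity of \<open>h\<close> are kept separate: they drive the
  construction of \<open>h\<close>, while the elimination step only needs a partner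
  \<open>h t\<close> for each \<open>t\<close>.\<close>

definition same_signs :: "(real \<Rightarrow> real) \<Rightarrow> real poly \<Rightarrow> real poly \<Rightarrow> bool" where
  "same_signs h p q \<longleftrightarrow> (\<forall>t. sgn (poly p t) = sgn (poly q (h t)))"

lemma same_signs_zero_iff: "same_signs h p q \<Longrightarrow> poly p t = 0 \<longleftrightarrow> poly q (h t) = 0"
  by (metis same_signs_def sgn_zero_iff)

text \<open>A zero of \<open>q\<close> between \<open>g t\<close> and \<open>h t\<close> has the
  form \<open>h c = g c\<close> for a root \<open>c\<close> of \<open>p\<close>, and as both maps
  increase this forces \<open>c = t\<close>. Otherwise \<open>q\<close> has no zero between the two
  points and hence the same sign at both. So a reparametrisation may be altered freely away from
  roots.\<close>

lemma same_signs_reparam: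
  assumes h: "strict_mono h" "surj h" and g: "strict_mono g"
    and s: "same_signs h p q" and eq: "\<And>c. p \<noteq> 0 \<Longrightarrow> poly p c = 0 \<Longrightarrow> g c = h c"
  shows "same_signs g p q"
proof (cases "p = 0")
  case True
  have "poly q y = 0" for y
    using h(2) same_signs_zero_iff[OF s] True by (metis poly_0 surj_def)
  then show ?thesis using True by (simp add: same_signs_def)
next
  case False
  have "sgn (poly q (h t)) = sgn (poly q (g t))" for t
  proof (cases "\<exists>w. poly q w = 0 \<and> min (g t) (h t) \<le> w \<and> w \<le> max (g t) (h t)")
    case True
    then obtain c where c: "poly q (h c) = 0" "min (g t) (h t) \<le> h c" "h c \<le> max (g t) (h t)"
      using h(2) by (metis surj_def)
    have "g c = h c" using eq False c same_signs_zero_iff[OF s] by auto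
    then have "c = t"
      using c strict_mono_less_eq[OF h(1)] strict_mono_less_eq[OF g]
      by (smt (verit, ccfv_threshold))
    then show ?thesis using \<open>g c = h c\<close> by simp
  next
    case F: False
    then have "sgn (poly q (min (g t) (h t))) = sgn (poly q (max (g t) (h t)))"
      by (intro sgn_poly_eq_if_no_root) auto
    then show ?thesis by (auto simp: min_def max_def split: if_splits)
  qed
  then show ?thesis using s by (auto simp: same_signs_def)
qed

text \<open>The roots of the members of \<open>F\<close>, among them the critical points of
  \<open>p\<close>, cut the line into gaps on which \<open>p\<close> is monotone. The signs of
  \<open>p\<close> at the gap ends and near infinity decide which gaps contain a root of
  \<open>p\<close>, at most one each, and \<open>q\<close> has the same data. Matching these roots
  in order, while keeping \<open>h\<close> on the old ones, gives \<open>g\<close>.\<close>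

lemma same_signs_extend:
  fixes u v :: "'i \<Rightarrow> real poly"
  assumes fin: "finite F"
    and h: "strict_mono h" "surj h" "\<And>i. i \<in> F \<Longrightarrow> same_signs h (u i) (v i)"
    and deg: "degree p = degree q" "degree p \<noteq> 0" "sgn (lead_coeff p) = sgn (lead_coeff q)"
    and d: "d \<in> F" "u d = pderiv p" "v d = pderiv q"
    and roots: "\<And>i c. i \<in> F \<Longrightarrow> u i \<noteq> 0 \<Longrightarrow> poly (u i) c = 0 \<Longrightarrow> sgn (poly p c) = sgn (poly q (h c))"
  shows "\<exists>g. strict_mono g \<and> surj g \<and> (\<forall>i\<in>F. same_signs g (u i) (v i)) \<and> same_signs g p q"
proof -
  \<comment> \<open>Members that vanish identically have infinitely many roots and are left out;
    \<open>same_signs_reparam\<close> imposes nothing for them.\<close>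
  define R where "R = (\<Union>i\<in>{i\<in>F. u i \<noteq> 0}. {c. poly (u i) c = 0})"
  have finR: "finite R" unfolding R_def using fin poly_roots_finite by auto
  have pq0: "p \<noteq> 0" "q \<noteq> 0" using deg by auto
  have pd0: "pderiv p \<noteq> 0" using deg by (simp add: pderiv_eq_0_iff)
  have dR: "c \<in> R" if "poly (pderiv p) c = 0" for c
    using that d pd0 unfolding R_def by (auto intro!: bexI[of _ d])
  obtain L0 where L0: "\<And>t. t \<le> L0 \<Longrightarrow> sgn (poly p t) = (-1) ^ degree p * sgn (lead_coeff p)"
    using sgn_poly_at_bot by metis
  obtain L1 where L1: "\<And>t. t \<le> L1 \<Longrightarrow> sgn (poly q t) = (-1) ^ degree q * sgn (lead_coeff q)"
    using sgn_poly_at_bot by metis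
  obtain U0 where U0: "\<And>t. t \<ge> U0 \<Longrightarrow> sgn (poly p t) = sgn (lead_coeff p)"
    using sgn_poly_at_top by metis
  obtain U1 where U1: "\<And>t. t \<ge> U1 \<Longrightarrow> sgn (poly q t) = sgn (lead_coeff q)"
    using sgn_poly_at_top by metis
  have below: "\<exists>L. L \<le> a \<and> (\<forall>c\<in>A. L < c)" if "finite A" for a :: real and A
  proof (intro exI conjI ballI)
    show "Min (insert a A) - 1 \<le> a" using Min_le[OF finite.insertI[OF that] insertI1, of a] by (simp del: Min_insert Min_le_iff add: algebra_simps)
    show "Min (insert a A) - 1 < c" if "c \<in> A" for c
      using Min_le[of "insert a A" c] that \<open>finite A\<close> by (smt (verit) finite.insertI insertI2)
  qed
  have above: "\<exists>U. a \<le> U \<and> (\<forall>c\<in>A. c < U)" if "finite A" for a :: real and A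
  proof (intro exI conjI ballI)
    show "a \<le> Max (insert a A) + 1" using Max_ge[OF finite.insertI[OF that] insertI1, of a] by (simp del: Max_insert Max_ge_iff add: algebra_simps)
    show "c < Max (insert a A) + 1" if "c \<in> A" for c
      using Max_ge[of "insert a A" c] that \<open>finite A\<close> by (smt (verit) finite.insertI insertI2)
  qed
  \<comment> \<open>\<open>L\<close> and \<open>U\<close> stand for the two points at infinity: they
    enclose all of \<open>R\<close>, and beyond them \<open>p\<close> has its asymptotic signs.
    \<open>L'\<close> and \<open>U'\<close> do the same for \<open>q\<close> and the image of
    \<open>R\<close>.\<close>
  obtain L where L: "L \<le> L0" "\<And>c. c \<in> R \<Longrightarrow> L < c" using below[OF finR] by metis
  obtain L' where L': "L' \<le> L1" "\<And>c. c \<in> h ` R \<Longrightarrow> L' < c" using below[of "h ` R"] finR by (metis finite_imageI)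
  obtain U where U: "U0 \<le> U" "\<And>c. c \<in> insert L R \<Longrightarrow> c < U" using above[of "insert L R"] finR by (metis finite_insert)
  obtain U' where U': "U1 \<le> U'" "\<And>c. c \<in> insert L' (h ` R) \<Longrightarrow> c < U'"
    using above[of "insert L' (h ` R)"] finR by (metis finite_insert finite_imageI)
  have root_LU: "L < c \<and> c < U" if "poly p c = 0" for c
    using L0[of c] U0[of c] that L(1) U(1) pq0 by (smt (verit) sgn_0 sgn_zero_iff leading_coeff_0_iff mult_eq_0_iff power_not_zero)
  define S0 where "S0 = insert L (insert U R)"
  have finS0: "finite S0" using finR by (simp add: S0_def)
  have LUS0: "L \<in> S0" "U \<in> S0" by (simp_all add: S0_def)
  \<comment> \<open>\<open>h\<close> need not send \<open>L\<close> to \<open>L'\<close> or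
    \<open>U\<close> to \<open>U'\<close>. Neither \<open>L\<close> nor \<open>U\<close> lies in
    \<open>R\<close>, so the values there may be reset.\<close>
  define k0 where "k0 c = (if c = L then L' else if c = U then U' else h c)" for c
  have "strict_mono_on S0 k0"
    using L(2) U(2) L'(2) U'(2) h(1)
    by (auto simp: strict_mono_on_def S0_def k0_def strict_mono_def less_imp_neq dest: less_asym)
  then obtain h1 where h1: "strict_mono h1" "surj h1" "\<And>c. c \<in> S0 \<Longrightarrow> h1 c = k0 c"
    using strict_mono_on_extend[OF finS0] by metis
  have h1R: "h1 c = h c" if "c \<in> R" for c
    using h1(3)[of c] that L(2)[of c] U(2)[of c] by (auto simp: k0_def S0_def)
  have h1LU: "h1 L = L'" "h1 U = U'"
    using h1(3)[of L] h1(3)[of U] U(2)[of L] by (auto simp: k0_def S0_def)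
  have sgnR: "sgn (poly p c) = sgn (poly q (h1 c))" if "c \<in> R" for c
    using that roots[of _ c] h1R[OF that] by (auto simp: R_def)
  have sgnS0: "sgn (poly p c) = sgn (poly q (h1 c))" if "c \<in> S0" for c
  proof -
    have "sgn (poly p L) = sgn (poly q (h1 L))"
      unfolding h1LU L0[OF L(1)] L1[OF L'(1)] deg(3) unfolding deg(1) ..
    moreover have "sgn (poly p U) = sgn (poly q (h1 U))"
      unfolding h1LU U0[OF U(1)] U1[OF U'(1)] by (rule deg(3))
    ultimately show ?thesis using that sgnR unfolding S0_def by blast
  qed
  \<comment> \<open>Across the gap of \<open>S0\<close> around a new root, \<open>p\<close> changes
    sign. The same holds for \<open>q\<close> across the image gap, and the intermediate value
    theorem gives a partner root there.\<close>
  have "\<exists>y. poly q y = 0 \<and> (\<forall>c\<in>S0. (c < r \<longrightarrow> h1 c < y) \<and> (r < c \<longrightarrow> y < h1 c))"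
    if r: "poly p r = 0" "r \<notin> S0" for r
  proof -
    have rLU: "L < r" "r < U" using root_LU[OF r(1)] by auto
    obtain a b where ab: "a \<in> S0" "b \<in> S0" "a < r" "r < b" "\<And>c. c \<in> S0 \<Longrightarrow> c \<le> a \<or> c = r \<or> b \<le> c"
      by (rule finite_neighbours[OF finS0 LUS0(1) rLU(1) LUS0(2) rLU(2)]) (rule that)
    have "poly p a * poly p b < 0"
    proof (rule poly_root_sign_change[OF ab(3,4) _ r(1)])
      show "poly (pderiv p) x \<noteq> 0" if "a < x" "x < b" for x
        using ab(5)[of x] dR[of x] r(2) that by (auto simp: S0_def)
    qed
    then have "poly q (h1 a) * poly q (h1 b) < 0"
      using mult_neg_cong_sgn[OF sgnS0[OF ab(1)] sgnS0[OF ab(2)]] by simp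
    moreover have "h1 a < h1 b" using ab h1(1) by (auto simp: strict_mono_def)
    ultimately obtain y where y: "h1 a < y" "y < h1 b" "poly q y = 0" using poly_IVT by blast
    have "h1 c \<le> h1 a" if "c \<in> S0" "c < r" for c
      using ab(4) ab(5)[OF that(1)] that(2) unfolding strict_mono_less_eq[OF h1(1)] by linarith
    moreover have ge_b: "h1 b \<le> h1 c" if "c \<in> S0" "r < c" for c
      using ab(3) ab(5)[OF that(1)] that(2) unfolding strict_mono_less_eq[OF h1(1)] by linarith
    ultimately have "h1 c < y" if "c \<in> S0" "c < r" for c
      using that y(1) le_less_trans by blast
    moreover have "y < h1 c" if "c \<in> S0" "r < c" for c
      using ge_b[OF that] y(2) by simp
    ultimately show ?thesis using y(3) by blast
  qed
  note root_ex = this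
  define \<rho> where "\<rho> r = (SOME y. poly q y = 0 \<and>
    (\<forall>c\<in>S0. (c < r \<longrightarrow> h1 c < y) \<and> (r < c \<longrightarrow> y < h1 c)))" for r
  have \<rho>: "poly q (\<rho> r) = 0" "c \<in> S0 \<Longrightarrow> c < r \<Longrightarrow> h1 c < \<rho> r" "c \<in> S0 \<Longrightarrow> r < c \<Longrightarrow> \<rho> r < h1 c"
    if "poly p r = 0" "r \<notin> S0" for r c
    using someI_ex[OF root_ex[OF that]] unfolding \<rho>_def by blast+
  define S where "S = S0 \<union> {r. poly p r = 0}"
  have finS: "finite S" using finS0 poly_roots_finite[OF pq0(1)] by (simp add: S_def)
  define k where "k c = (if c \<in> S0 then h1 c else \<rho> c)" for c
  have "strict_mono_on S k"
  proof (rule strict_mono_onI)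
    fix s t assume st: "s \<in> S" "t \<in> S" "s < t"
    show "k s < k t"
    proof (cases "s \<in> S0 \<or> t \<in> S0")
      case True
      consider "s \<in> S0" "t \<in> S0" | "s \<in> S0" "t \<notin> S0" "poly p t = 0" | "s \<notin> S0" "t \<in> S0" "poly p s = 0"
        using st True by (auto simp: S_def)
      then show ?thesis
        using \<rho>(2)[of t s] \<rho>(3)[of s t] st(3) h1(1) by cases (simp_all add: k_def strict_mono_less)
    next
      case False
      then have pst: "poly p s = 0" "poly p t = 0" using st by (auto simp: S_def)
      \<comment> \<open>By Rolle, two new roots are separated by a critical point. It lies in
        \<open>S0\<close>, and its image separates their images, so the independent choices made by
        \<open>\<rho>\<close> come out in the right order.\<close>
      obtain c where c: "s < c" "c < t" "poly (pderiv p) c = 0"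
        using poly_MVT[OF st(3), of p] pst st(3) by auto
      then have "c \<in> S0" using dR by (auto simp: S0_def)
      then have "\<rho> s < h1 c" "h1 c < \<rho> t" using \<rho> pst c False by auto
      then show ?thesis using False by (auto simp: k_def)
    qed
  qed
  then obtain g where g: "strict_mono g" "surj g" "\<And>c. c \<in> S \<Longrightarrow> g c = k c"
    using strict_mono_on_extend[OF finS] by metis
  have gS0: "g c = h1 c" if "c \<in> S0" for c using g(3) that by (auto simp: S_def k_def)
  have sim: "same_signs g (u i) (v i)" if "i \<in> F" for i
  proof (rule same_signs_reparam[OF h(1,2) g(1) h(3)[OF that]])
    fix c assume "u i \<noteq> 0" "poly (u i) c = 0"
    then have "c \<in> R" using that by (auto simp: R_def)
    then show "g c = h c" using gS0[of c] h1R by (auto simp: S0_def)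
  qed
  have simp': "same_signs g (pderiv p) (pderiv q)" using sim[OF d(1)] d by simp
  have sgnS: "sgn (poly p c) = sgn (poly q (g c))" if "c \<in> S" for c
    using that sgnS0[of c] gS0[of c] \<rho>(1)[of c] g(3)[OF that] by (cases "c \<in> S0") (auto simp: S_def k_def)
  have gLU: "g L = L'" "g U = U'" using gS0 h1LU by (auto simp: S0_def)
  have "sgn (poly p t) = sgn (poly q (g t))" for t
  proof -
    consider "t \<in> S" | "t < L" | "U < t" | "t \<notin> S" "L < t" "t < U"
      using LUS0 unfolding S_def by (cases t L rule: linorder_cases; cases t U rule: linorder_cases) auto
    then show ?thesis
    proof cases
      case 1
      then show ?thesis by (rule sgnS)
    next
      case 2
      then have "g t < L'" using g(1) gLU by (auto simp: strict_mono_def)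
      then show ?thesis using L0[of t] L1[of "g t"] 2 L(1) L'(1) deg by auto
    next
      case 3
      then have "U' < g t" using g(1) gLU by (auto simp: strict_mono_def)
      then show ?thesis using U0[of t] U1[of "g t"] 3 U(1) U'(1) deg by auto
    next
      case 4
      have LUS: "L \<in> S" "U \<in> S" by (auto simp: S_def S0_def)
      obtain a b where ab: "a \<in> S" "b \<in> S" "a < t" "t < b" "\<And>c. c \<in> S \<Longrightarrow> c \<le> a \<or> c = t \<or> b \<le> c"
        by (rule finite_neighbours[OF finS LUS(1) 4(2) LUS(2) 4(3)]) (rule that)
      have notS: "c \<notin> S" if "a < c" "c < b" for c using ab(5)[of c] that 4(1) by auto
      have p': "poly (pderiv p) c \<noteq> 0" if "a < c" "c < b" for c
        using notS[OF that] dR[of c] by (auto simp: S_def S0_def)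
      have q': "poly (pderiv q) y \<noteq> 0" if "g a < y" "y < g b" for y
      proof -
        obtain c where c: "y = g c" using g(2) by (metis surj_def)
        then have "a < c" "c < b" using that g(1) by (auto simp: strict_mono_less)
        then show ?thesis using p' same_signs_zero_iff[OF simp'] c by auto
      qed
      \<comment> \<open>All roots of \<open>p\<close> lie in \<open>S\<close>, so a gap of
        \<open>S\<close> contains none and the end values are not of opposite sign.\<close>
      have "\<not> poly p a * poly p b < 0"
        proof
        assume "poly p a * poly p b < 0"
        then obtain x where "a < x" "x < b" "poly p x = 0"
          using poly_IVT[of a b p] ab(3,4) by auto
        then show False using notS[of x] by (auto simp: S_def)
      qed
      then have pe: "poly p a * poly p b \<ge> 0" by simp
      then have "poly q (g a) * poly q (g b) \<ge> 0"
        using mult_neg_cong_sgn[OF sgnS[OF ab(1)] sgnS[OF ab(2)]] by simp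
      moreover have "g a < g t" "g t < g b" using ab g(1) by (auto simp: strict_mono_def)
      ultimately have "sgn (poly q (g t)) = sgn (sgn (poly q (g a)) + sgn (poly q (g b)))"
        using q' by (intro sgn_poly_between) auto
      moreover have "sgn (poly p t) = sgn (sgn (poly p a) + sgn (poly p b))"
        using p' pe ab by (intro sgn_poly_between) auto
      ultimately show ?thesis using sgnS[OF ab(1)] sgnS[OF ab(2)] by simp
    qed
  qed
  then show ?thesis using g sim by (auto simp: same_signs_def)
qed

section \<open>Families closed under operations that lower a formal degree\<close>

text \<open>Each result has smaller degree than both arguments, so an element that first appears in
  stage \<open>i + 1\<close> has degree less than \<open>N - i\<close>. From stage \<open>N\<close>
  on nothing is new.\<close>

lemma finite_closure:
  fixes deg :: "'a \<Rightarrow> nat" and ops :: "'a \<Rightarrow> 'a \<Rightarrow> 'a set"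
  assumes P: "finite P" "P \<subseteq> U"
    and ops: "\<And>p q. p \<in> U \<Longrightarrow> q \<in> U \<Longrightarrow> finite (ops p q) \<and> ops p q \<subseteq> U"
    and deg: "\<And>p q r. r \<in> ops p q \<Longrightarrow> deg r < deg p \<and> deg r < deg q"
  shows "\<exists>C. finite C \<and> P \<subseteq> C \<and> C \<subseteq> U \<and> (\<forall>p\<in>C. \<forall>q\<in>C. ops p q \<subseteq> C)"
proof -
  define step where "step S = S \<union> (\<Union>p\<in>S. \<Union>q\<in>S. ops p q)" for S
  define St where "St i = (step ^^ i) P" for i
  have St_Suc: "St (Suc i) = step (St i)" for i by (simp add: St_def)
  have St_0: "St 0 = P" by (simp add: St_def)
  have fin: "finite (St i) \<and> St i \<subseteq> U" for i
  proof (induction i)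
    case 0
    then show ?case using P by (simp add: St_0)
  next
    case (Suc i)
    then have "finite (ops p q) \<and> ops p q \<subseteq> U" if "p \<in> St i" "q \<in> St i" for p q
      using ops[of p q] that by blast
    then have "finite (\<Union>p\<in>St i. \<Union>q\<in>St i. ops p q)" "(\<Union>p\<in>St i. \<Union>q\<in>St i. ops p q) \<subseteq> U"
      using Suc by (simp_all add: UN_subset_iff)
    then show ?case using Suc by (simp add: St_Suc step_def)
  qed
  have sub: "P \<subseteq> St i" for i
    by (induction i) (auto simp: St_0 St_Suc step_def)
  obtain N where N: "\<And>p. p \<in> P \<Longrightarrow> deg p \<le> N"
    using P(1) finite_nat_set_iff_bounded_le[of "deg ` P"] by auto
  have stable: "r \<in> St i" if "r \<in> St (Suc i)" "N \<le> i + j" "j \<le> deg r" for r i j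
    using that
  proof (induction i arbitrary: j r)
    case 0
    show ?case
    proof (rule ccontr)
      assume "r \<notin> St 0"
      then obtain p q where "p \<in> P" "r \<in> ops p q" using 0 by (auto simp: St_Suc step_def St_0)
      then show False using deg[of r p q] N[of p] 0 by auto
    qed
  next
    case (Suc i)
    show ?case
    proof (rule ccontr)
      assume n: "r \<notin> St (Suc i)"
      then obtain p q where pq: "p \<in> St (Suc i)" "q \<in> St (Suc i)" "r \<in> ops p q"
        using Suc.prems(1) by (auto simp: St_Suc[of "Suc i"] step_def)
      \<comment> \<open>Both arguments have degree greater than \<open>j\<close>, so the induction
        hypothesis with \<open>Suc j\<close> places them one stage earlier, and \<open>r\<close> was
        not new after all.\<close>
      then have "p \<in> St i" "q \<in> St i"
        using Suc.IH[OF pq(1), of "Suc j"] Suc.IH[OF pq(2), of "Suc j"] deg[OF pq(3)] Suc.prems by simp_all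
      then show False using n pq(3) by (auto simp: St_Suc step_def)
    qed
  qed
  have "ops p q \<subseteq> St N" if "p \<in> St N" "q \<in> St N" for p q
  proof
    fix r assume "r \<in> ops p q"
    then have "r \<in> St (Suc N)" using that by (auto simp: St_Suc step_def)
    then show "r \<in> St N" using stable[of r N 0] by simp
  qed
  then show ?thesis using fin[of N] sub[of N] by (intro exI[of _ "St N"]) auto
qed

text \<open>
  The first component is a formal degree. The degree of the specialised polynomial may drop below it
  where the leading coefficient vanishes.
\<close>

definition fpolys :: "(nat \<times> (('v \<Rightarrow> real) \<Rightarrow> real poly)) set" where
  "fpolys = {(n, p). (\<forall>x. degree (p x) \<le> n) \<and> (\<forall>j. (\<lambda>x. coeff (p x) j) \<in> polyfuns)}"

lemma fpolysI:
  "(\<And>x. degree (p x) \<le> n) \<Longrightarrow> (\<And>j. (\<lambda>x. coeff (p x) j) \<in> polyfuns) \<Longrightarrow> (n, p) \<in> fpolys"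
  by (auto simp: fpolys_def)

lemma fpolysD:
  assumes "P \<in> fpolys"
  shows "degree (snd P x) \<le> fst P" "(\<lambda>x. coeff (snd P x) j) \<in> polyfuns"
  using assms by (auto simp: fpolys_def)

lemma fpolys_mono: "(n, p) \<in> fpolys \<Longrightarrow> n \<le> m \<Longrightarrow> (m, p) \<in> fpolys"
  by (auto simp: fpolys_def dest: spec) (drule spec, erule le_trans)

text \<open>Where the formal leading coefficient vanishes, this is the same polynomial with a
  smaller formal degree. Drops of degree are handled in this way.\<close>

definition fpoly_trunc :: "nat \<times> (('v \<Rightarrow> real) \<Rightarrow> real poly) \<Rightarrow> nat \<times> (('v \<Rightarrow> real) \<Rightarrow> real poly)" where
  "fpoly_trunc P = (fst P - 1, \<lambda>x. snd P x - monom (coeff (snd P x) (fst P)) (fst P))"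

definition fpoly_deriv :: "nat \<times> (('v \<Rightarrow> real) \<Rightarrow> real poly) \<Rightarrow> nat \<times> (('v \<Rightarrow> real) \<Rightarrow> real poly)" where
  "fpoly_deriv P = (fst P - 1, \<lambda>x. pderiv (snd P x))"

lemma fpoly_trunc_in_fpolys: "P \<in> fpolys \<Longrightarrow> fpoly_trunc P \<in> fpolys"
  unfolding fpoly_trunc_def
proof (rule fpolysI)
  fix x assume P: "P \<in> fpolys"
  show "degree (snd P x - monom (coeff (snd P x) (fst P)) (fst P)) \<le> fst P - 1"
  proof (rule degree_le, intro allI impI)
    fix i assume "fst P - 1 < i"
    then show "coeff (snd P x - monom (coeff (snd P x) (fst P)) (fst P)) i = 0"
      using fpolysD(1)[OF P, of x] coeff_eq_0[of "snd P x" i] by (cases "i = fst P") auto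
  qed
next
  fix j assume P: "P \<in> fpolys"
  show "(\<lambda>x. coeff (snd P x - monom (coeff (snd P x) (fst P)) (fst P)) j) \<in> polyfuns"
    using fpolysD(2)[OF P] by (cases "j = fst P") (auto intro: polyfuns_const)
qed

lemma fpoly_deriv_in_fpolys:
  assumes "P \<in> fpolys"
  shows "fpoly_deriv P \<in> fpolys"
  unfolding fpoly_deriv_def
proof (rule fpolysI)
  show "degree (pderiv (snd P x)) \<le> fst P - 1" for x
    using fpolysD(1)[OF assms, of x] unfolding degree_pderiv by (rule diff_le_mono)
  show "(\<lambda>x. coeff (pderiv (snd P x)) j) \<in> polyfuns" for j
    unfolding coeff_pderiv by (intro polyfuns_mult polyfuns_const fpolysD(2)[OF assms])
qed

text \<open>Division without denominators: each step multiplies \<open>p\<close> by the square of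
  the leading coefficient of \<open>q\<close> and subtracts a multiple of \<open>q\<close>. At a
  root of \<open>q\<close> only the square factor remains, and being positive it keeps the sign; the
  first power would not.\<close>

lemma pseudo_rem_exists:
  assumes "(n, p) \<in> fpolys" "(m, q) \<in> fpolys" "0 < m"
  shows "\<exists>r. (m - 1, r) \<in> fpolys \<and> (\<forall>x t. poly (q x) t = 0 \<longrightarrow> coeff (q x) m \<noteq> 0 \<longrightarrow>
    sgn (poly (r x) t) = sgn (poly (p x) t))"
  using assms(1)
proof (induction n arbitrary: p)
  case 0
  then have "(m - 1, p) \<in> fpolys" by (rule fpolys_mono) simp
  then show ?case by (intro exI[of _ p]) simp
next
  case (Suc n)
  show ?case
  proof (cases "Suc n < m")
    case True
    then have "(m - 1, p) \<in> fpolys" using Suc.prems by (elim fpolys_mono) simp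
    then show ?thesis by (intro exI[of _ p]) simp
  next
    case False
    note P = fpolysD[OF Suc.prems, simplified] and Q = fpolysD[OF assms(2), simplified]
    \<comment> \<open>With \<open>b\<close> and \<open>a\<close> the formal leading coefficients of
      \<open>q\<close> and \<open>p\<close>, the top terms of both summands are
      \<open>b * b * a\<close> and cancel.\<close>
    define p1 where "p1 x = smult ((coeff (q x) m)^2) (p x)
      - smult (coeff (q x) m * coeff (p x) (Suc n)) (monom 1 (Suc n - m) * q x)" for x
    have cf: "coeff (p1 x) j = (coeff (q x) m)^2 * coeff (p x) j - coeff (q x) m * coeff (p x) (Suc n) *
      (if Suc n - m \<le> j then coeff (q x) (j - (Suc n - m)) else 0)" for x j
      by (simp add: p1_def coeff_monom_mult)
    have "degree (p1 x) \<le> n" for x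
    proof (rule degree_le, intro allI impI)
      fix i assume i: "n < i"
      show "coeff (p1 x) i = 0"
      proof (cases "i = Suc n")
        case True
        then show ?thesis using False by (simp add: cf power2_eq_square)
      next
        case F: False
        then have "coeff (p x) i = 0" "coeff (q x) (i - (Suc n - m)) = 0"
          using i P(1)[of x] Q(1)[of x] False by (auto intro!: coeff_eq_0)
        then show ?thesis by (simp add: cf)
      qed
    qed
    moreover have "(\<lambda>x. coeff (p1 x) j) \<in> polyfuns" for j
    proof (cases "Suc n - m \<le> j")
      case True
      then show ?thesis unfolding cf if_P[OF True]
        by (intro polyfuns_diff polyfuns_mult polyfuns_power P(2) Q(2))
    next
      case False
      then show ?thesis unfolding cf if_not_P[OF False]
        by (intro polyfuns_diff polyfuns_mult polyfuns_power polyfuns_const P(2) Q(2))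
    qed
    ultimately have "(n, p1) \<in> fpolys" by (rule fpolysI)
    from Suc.IH[OF this] obtain r where r: "(m - 1, r) \<in> fpolys"
      "\<And>x t. poly (q x) t = 0 \<Longrightarrow> coeff (q x) m \<noteq> 0 \<Longrightarrow> sgn (poly (r x) t) = sgn (poly (p1 x) t)"
      by blast
    have "sgn (poly (p1 x) t) = sgn (poly (p x) t)" if "poly (q x) t = 0" "coeff (q x) m \<noteq> 0" for x t
      using that by (simp add: p1_def sgn_mult power2_eq_square)
    then have "\<forall>x t. poly (q x) t = 0 \<longrightarrow> coeff (q x) m \<noteq> 0 \<longrightarrow> sgn (poly (r x) t) = sgn (poly (p x) t)"
      using r(2) by simp
    then show ?thesis using r(1) by blast
  qed
qed

text \<open>
  Hoermander's induction: at a root of another member \<open>Q\<close> of the family, \<open>P\<close> has the sign of its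
  pseudo-remainder modulo \<open>Q\<close>, and between consecutive such roots (including those of its derivative)
  \<open>P\<close> is monotone. So the sign diagram of \<open>P\<close> is determined by members of lower formal degree.
\<close>

lemma same_signs_family:
  fixes C :: "(nat \<times> (('v \<Rightarrow> real) \<Rightarrow> real poly)) set"
  assumes C: "finite C" "C \<subseteq> fpolys"
    and trunc: "\<And>P. P \<in> C \<Longrightarrow> 0 < fst P \<Longrightarrow> fpoly_trunc P \<in> C"
    and deriv: "\<And>P. P \<in> C \<Longrightarrow> 0 < fst P \<Longrightarrow> fpoly_deriv P \<in> C"
    and rem: "\<And>P Q. P \<in> C \<Longrightarrow> Q \<in> C \<Longrightarrow> 0 < fst Q \<Longrightarrow> fst Q \<le> fst P \<Longrightarrow>
      \<exists>R\<in>C. fst R < fst Q \<and> (\<forall>x t. poly (snd Q x) t = 0 \<longrightarrow> coeff (snd Q x) (fst Q) \<noteq> 0 \<longrightarrow>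
        sgn (poly (snd R x) t) = sgn (poly (snd P x) t))"
    and signs: "\<And>P j. P \<in> C \<Longrightarrow> sgn (coeff (snd P x) j) = sgn (coeff (snd P y) j)"
    and G: "G \<subseteq> C" "\<And>P Q. P \<in> G \<Longrightarrow> Q \<in> C \<Longrightarrow> fst Q < fst P \<Longrightarrow> Q \<in> G"
  shows "\<exists>h. strict_mono h \<and> surj h \<and> (\<forall>P\<in>G. same_signs h (snd P x) (snd P y))"
proof -
  have "finite G" using C(1) G(1) finite_subset by blast
  then show ?thesis using G
  proof (induction G rule: finite_psubset_induct)
    case (psubset G)
    show ?case
    proof (cases "G = {}")
      case True
      then show ?thesis by (intro exI[of _ "\<lambda>x. x"]) (auto simp: strict_mono_def)
    next
      case False
      have "Max (fst ` G) \<in> fst ` G" using False psubset.hyps by (intro Max_in) auto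
      then obtain P where P: "P \<in> G" "Max (fst ` G) = fst P" by auto
      have Pmax: "fst Q \<le> fst P" if "Q \<in> G" for Q
        using Max_ge[of "fst ` G" "fst Q"] that psubset.hyps P(2) by auto
      \<comment> \<open>Removing a member of maximal formal degree leaves a family still closed
        under passing to members of lower formal degree.\<close>
      define F where "F = G - {P}"
      have PC: "P \<in> C" using P psubset.prems(1) by auto
      have FC: "F \<subseteq> C" and finF: "finite F" using psubset by (auto simp: F_def)
      have lower: "Q \<in> F" if "Q \<in> C" "fst Q < fst P" for Q
        using psubset.prems(2)[OF P(1) that] that by (auto simp: F_def)
      have "\<exists>h. strict_mono h \<and> surj h \<and> (\<forall>P\<in>F. same_signs h (snd P x) (snd P y))"
      proof (rule psubset.IH)
        show "F \<subset> G" "F \<subseteq> C" using P psubset.prems by (auto simp: F_def)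
        show "Q \<in> F" if "R \<in> F" "Q \<in> C" "fst Q < fst R" for R Q
        proof (rule lower)
          show "fst Q < fst P" using Pmax[of R] that by (auto simp: F_def)
        qed fact
      qed
      then obtain h where h: "strict_mono h" "surj h" "\<And>Q. Q \<in> F \<Longrightarrow> same_signs h (snd Q x) (snd Q y)"
        by blast
      define n where "n = fst P"
      have sg: "sgn (coeff (snd Q x) j) = sgn (coeff (snd Q y) j)" if "Q \<in> C" for Q j
        using signs[OF that] .
      have degP: "degree (snd P z) \<le> n" for z using fpolysD(1)[OF subsetD[OF C(2) PC]] by (simp add: n_def)
      \<comment> \<open>The distinction is made at \<open>x\<close>, and equal signs of coefficients
        carry it over to \<open>y\<close>. In the second case \<open>P\<close> agrees at both points
        with its truncation, which already belongs to \<open>F\<close>; in the third the formal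
        degree is the true degree at both.\<close>
      consider "n = 0" | "0 < n" "coeff (snd P x) n = 0" | "0 < n" "coeff (snd P x) n \<noteq> 0" by auto
      then have "\<exists>g. strict_mono g \<and> surj g \<and> (\<forall>Q\<in>F. same_signs g (snd Q x) (snd Q y)) \<and>
        same_signs g (snd P x) (snd P y)"
      proof cases
        case 1
        have "poly (snd P z) t = coeff (snd P z) 0" for z t
          using degP[of z] 1 by (auto elim!: degree_eq_zeroE)
        then have "same_signs h (snd P x) (snd P y)" using sg[OF PC] by (simp add: same_signs_def)
        then show ?thesis using h by blast
      next
        case 2
        have "coeff (snd P y) n = 0" using sg[OF PC, of n] 2 by (simp add: sgn_zero_iff)
        then have "snd (fpoly_trunc P) x = snd P x" "snd (fpoly_trunc P) y = snd P y"
          using 2 by (simp_all add: fpoly_trunc_def n_def)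
        moreover have "fpoly_trunc P \<in> F" using trunc PC 2 by (intro lower) (auto simp: n_def fpoly_trunc_def)
        ultimately show ?thesis using h by metis
      next
        case 3
        have cy: "coeff (snd P y) n \<noteq> 0" using sg[OF PC, of n] 3 by (metis sgn_zero_iff)
        have dg: "degree (snd P x) = n" "degree (snd P y) = n"
          using degP cy 3(2) by (auto intro!: antisym le_degree)
        have D: "fpoly_deriv P \<in> F" using deriv PC 3 by (intro lower) (auto simp: n_def fpoly_deriv_def)
        show ?thesis
        proof (rule same_signs_extend[OF finF h(1,2)])
          show "same_signs h (snd Q x) (snd Q y)" if "Q \<in> F" for Q by (rule h(3)[OF that])
          show "degree (snd P x) = degree (snd P y)" "degree (snd P x) \<noteq> 0"
            "sgn (lead_coeff (snd P x)) = sgn (lead_coeff (snd P y))"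
            using dg 3 sg[OF PC] by auto
          show "fpoly_deriv P \<in> F" by (rule D)
          show "snd (fpoly_deriv P) x = pderiv (snd P x)" "snd (fpoly_deriv P) y = pderiv (snd P y)"
            by (simp_all add: fpoly_deriv_def)
          fix Q c assume Q: "Q \<in> F" "snd Q x \<noteq> 0" "poly (snd Q x) c = 0"
          \<comment> \<open>Among the members equal to \<open>Q\<close> at \<open>x\<close>, one of
            least formal degree has nonzero formal leading coefficient there, since otherwise its
            truncation would be smaller. This is the condition under which the pseudo-remainder
            shows the sign of \<open>P\<close>. It is harmless that \<open>Q'\<close> and
            \<open>Q\<close> may differ at \<open>y\<close>, as \<open>h\<close> matches the roots
            of \<open>Q'\<close> itself.\<close>
          define good where "good m \<longleftrightarrow> (\<exists>Q'\<in>F. snd Q' x = snd Q x \<and> fst Q' = m)" for m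
          have "good (fst Q)" using Q(1) by (auto simp: good_def)
          then have "good (LEAST m. good m)" by (rule LeastI)
          then obtain Q' where Q': "Q' \<in> F" "snd Q' x = snd Q x" "fst Q' = (LEAST m. good m)"
            by (auto simp: good_def)
          have Q'C: "Q' \<in> C" and Q'P: "fst Q' \<le> fst P" using Q'(1) FC Pmax by (auto simp: F_def)
          have pos: "0 < fst Q'"
          proof (rule ccontr)
            assume "\<not> 0 < fst Q'"
            then have "degree (snd Q x) = 0" using fpolysD(1)[of Q' x] Q'C C(2) Q'(2) by auto
            then show False using Q(2,3) by (auto elim!: degree_eq_zeroE)
          qed
          have nz: "coeff (snd Q' x) (fst Q') \<noteq> 0"
          proof
            assume "coeff (snd Q' x) (fst Q') = 0"
            then have "snd (fpoly_trunc Q') x = snd Q x" using Q'(2) by (simp add: fpoly_trunc_def)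
            moreover have "fst (fpoly_trunc Q') < fst Q'" using pos by (simp add: fpoly_trunc_def)
            moreover have "fpoly_trunc Q' \<in> F" using trunc Q'C pos Q'P by (intro lower) (auto simp: fpoly_trunc_def)
            ultimately have "good (fst (fpoly_trunc Q'))" "fst (fpoly_trunc Q') < fst Q'" by (auto simp: good_def)
            then show False using Least_le[of good] Q'(3) by (metis not_le)
          qed
          have nzy: "coeff (snd Q' y) (fst Q') \<noteq> 0" using sg[OF Q'C] nz by (metis sgn_zero_iff)
          obtain R where R: "R \<in> C" "fst R < fst Q'"
            "\<And>x t. poly (snd Q' x) t = 0 \<Longrightarrow> coeff (snd Q' x) (fst Q') \<noteq> 0 \<Longrightarrow>
              sgn (poly (snd R x) t) = sgn (poly (snd P x) t)"
            using rem[OF PC Q'C pos Q'P] by blast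
          have RF: "R \<in> F" using R Q'P by (intro lower) auto
          have "poly (snd Q' y) (h c) = 0"
            using same_signs_zero_iff[OF h(3)[OF Q'(1)], of c] Q'(2) Q(3) by auto
          then show "sgn (poly (snd P x) c) = sgn (poly (snd P y) (h c))"
            using R(3)[of x c] R(3)[of y "h c"] nz nzy Q'(2) Q(3) h(3)[OF RF]
            by (simp add: same_signs_def)
        qed
      qed
      then show ?thesis using P(1) by (auto simp: F_def)
    qed
  qed
qed

text \<open>The family is closed under truncation, derivative and pseudo-remainder; the deciding
  polynomials are all coefficients of the members of this closure.\<close>

lemma sign_determined:
  assumes "finite P" "P \<subseteq> (fpolys :: (nat \<times> (('v \<Rightarrow> real) \<Rightarrow> real poly)) set)"
  shows "\<exists>B. finite B \<and> B \<subseteq> polyfuns \<and> (\<forall>x y. (\<forall>b\<in>B. sgn (b x) = sgn (b y)) \<longrightarrow>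
    (\<exists>h. \<forall>p\<in>P. same_signs h (snd p x) (snd p y)))"
proof -
  define is_rem where "is_rem p q R \<longleftrightarrow> R \<in> fpolys \<and> fst R = fst q - 1 \<and>
     (\<forall>x t. poly (snd q x) t = 0 \<longrightarrow> coeff (snd q x) (fst q) \<noteq> 0 \<longrightarrow>
        sgn (poly (snd R x) t) = sgn (poly (snd p x) t))"
    for p q R :: "nat \<times> (('v \<Rightarrow> real) \<Rightarrow> real poly)"
  \<comment> \<open>One remainder is fixed for each pair, so that closing the family adds only
    finitely many elements.\<close>
  define rem where "rem p q = (SOME R. is_rem p q R)" for p q
  have is_rem: "is_rem p q (rem p q)" if "p \<in> fpolys" "q \<in> fpolys" "0 < fst q" for p q
  proof -
    have "\<exists>r. is_rem p q (fst q - 1, r)"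
      using pseudo_rem_exists[of "fst p" "snd p" "fst q" "snd q"] that
      unfolding is_rem_def by simp
    then show ?thesis unfolding rem_def by (auto intro: someI)
  qed
  have rem: "rem p q \<in> fpolys" "fst (rem p q) = fst q - 1"
    "poly (snd q x) t = 0 \<Longrightarrow> coeff (snd q x) (fst q) \<noteq> 0 \<Longrightarrow>
        sgn (poly (snd (rem p q) x) t) = sgn (poly (snd p x) t)"
    if "p \<in> fpolys" "q \<in> fpolys" "0 < fst q" for p q x t
    using is_rem[OF that] by (auto simp: is_rem_def)
  \<comment> \<open>The unary operations are placed on the diagonal, so that one binary operation
    covers all three. The restriction \<open>fst q \<le> fst p\<close> makes the degree of a
    remainder drop below both arguments.\<close>
  define ops where "ops p q = (if p \<in> fpolys \<and> q \<in> fpolys \<and> 0 < fst q \<and> fst q \<le> fst p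
    then insert (rem p q) (if p = q then {fpoly_trunc p, fpoly_deriv p} else {}) else {})"
    for p q :: "nat \<times> (('v \<Rightarrow> real) \<Rightarrow> real poly)"
  have "\<exists>C. finite C \<and> P \<subseteq> C \<and> C \<subseteq> fpolys \<and> (\<forall>p\<in>C. \<forall>q\<in>C. ops p q \<subseteq> C)"
  proof (rule finite_closure[OF assms])
    show "finite (ops p q) \<and> ops p q \<subseteq> fpolys" if "p \<in> fpolys" "q \<in> fpolys" for p q
      using rem(1)[OF that] that by (auto simp: ops_def fpoly_trunc_in_fpolys fpoly_deriv_in_fpolys)
    show "fst r < fst p \<and> fst r < fst q" if "r \<in> ops p q" for p q r
      using that rem(2)[of p q] by (auto simp: ops_def fpoly_trunc_def fpoly_deriv_def split: if_splits)
  qed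
  then obtain C where C: "finite C" "P \<subseteq> C" "C \<subseteq> fpolys" "\<And>p q. p \<in> C \<Longrightarrow> q \<in> C \<Longrightarrow> ops p q \<subseteq> C"
    by blast
  define B where "B = (\<Union>p\<in>C. (\<lambda>j x. coeff (snd p x) j) ` {..fst p})"
  have "finite B" using C(1) by (simp add: B_def)
  moreover have "B \<subseteq> polyfuns"
    unfolding B_def using fpolysD(2) C(3) by (intro UN_least image_subsetI) blast
  moreover have "\<exists>h. \<forall>p\<in>P. same_signs h (snd p x) (snd p y)"
    if s: "\<forall>b\<in>B. sgn (b x) = sgn (b y)" for x y
  proof -
    have "\<exists>h. strict_mono h \<and> surj h \<and> (\<forall>p\<in>C. same_signs h (snd p x) (snd p y))"
    proof (rule same_signs_family[OF C(1,3)])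
      show "fpoly_trunc p \<in> C" "fpoly_deriv p \<in> C" if "p \<in> C" "0 < fst p" for p
        using C(4)[OF that(1) that(1)] that C(3) by (auto simp: ops_def)
      show "\<exists>R\<in>C. fst R < fst q \<and> (\<forall>x t. poly (snd q x) t = 0 \<longrightarrow> coeff (snd q x) (fst q) \<noteq> 0 \<longrightarrow>
        sgn (poly (snd R x) t) = sgn (poly (snd p x) t))"
        if "p \<in> C" "q \<in> C" "0 < fst q" "fst q \<le> fst p" for p q
      proof -
        have pq: "p \<in> fpolys" "q \<in> fpolys" using that C(3) by auto
        then have "rem p q \<in> ops p q" using that by (simp add: ops_def)
        then have "rem p q \<in> C" using C(4)[OF that(1,2)] by auto
        then show ?thesis using rem(2,3)[OF pq that(3)] that(3) by (intro bexI[of _ "rem p q"]) auto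
      qed
      show "sgn (coeff (snd p x) j) = sgn (coeff (snd p y) j)" if "p \<in> C" for p j
      proof (cases "j \<le> fst p")
        case True
        then have "(\<lambda>x. coeff (snd p x) j) \<in> B" using that by (auto simp: B_def)
        then show ?thesis using s by auto
      next
        case False
        then have "degree (snd p z) < j" for z using fpolysD(1)[of p z] C(3) that by auto
        then show ?thesis by (simp add: coeff_eq_0)
      qed
    qed auto
    then show ?thesis using C(2) by blast
  qed
  ultimately show ?thesis by blast
qed

subsection \<open>Semialgebraic predicates\<close>

text \<open>
  Up to Boolean equivalence, this says that \<open>S\<close> is a finite union of cells given by sign conditions on
  finitely many polynomials. In this form closure under Boolean operations is immediate.
\<close>

definition semialgebraic :: "(('v \<Rightarrow> real) \<Rightarrow> bool) \<Rightarrow> bool" where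
  "semialgebraic S \<longleftrightarrow> (\<exists>B. finite B \<and> B \<subseteq> polyfuns \<and>
     (\<forall>x y. (\<forall>b\<in>B. sgn (b x) = sgn (b y)) \<longrightarrow> S x = S y))"

lemma semialgebraicI:
  assumes "finite B" "B \<subseteq> polyfuns"
    and "\<And>x y. (\<And>b. b \<in> B \<Longrightarrow> sgn (b x) = sgn (b y)) \<Longrightarrow> S x = S y"
  shows "semialgebraic S"
  unfolding semialgebraic_def
proof (intro exI[of _ B] conjI allI impI)
  fix x y assume "\<forall>b\<in>B. sgn (b x) = sgn (b y)"
  then show "S x = S y" using assms(3)[of x y] by simp
qed (rule assms)+

lemma semialgebraic_le:
  assumes "f \<in> polyfuns" "g \<in> polyfuns"
  shows "semialgebraic (\<lambda>x. f x \<le> g x)"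
proof (rule semialgebraicI[of "{\<lambda>x. f x - g x}"])
  fix x y assume "\<And>b. b \<in> {\<lambda>x. f x - g x} \<Longrightarrow> sgn (b x) = sgn (b y)"
  then have "sgn (f x - g x) = sgn (f y - g y)" by simp
  then show "(f x \<le> g x) = (f y \<le> g y)" by (metis diff_gt_0_iff_gt not_le sgn_greater)
qed (use assms polyfuns_diff in auto)

lemma semialgebraic_not: "semialgebraic S \<Longrightarrow> semialgebraic (\<lambda>x. \<not> S x)"
  by (simp add: semialgebraic_def)

lemma semialgebraic_const: "semialgebraic (\<lambda>x. c)"
  by (rule semialgebraicI[of "{}"]) auto

lemma semialgebraic_conj:
  assumes "semialgebraic S" "semialgebraic T"
  shows "semialgebraic (\<lambda>x. S x \<and> T x)"
proof -
  obtain A where A: "finite A" "A \<subseteq> polyfuns" "\<forall>x y. (\<forall>b\<in>A. sgn (b x) = sgn (b y)) \<longrightarrow> S x = S y"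
    using assms(1) unfolding semialgebraic_def by blast
  obtain B where B: "finite B" "B \<subseteq> polyfuns" "\<forall>x y. (\<forall>b\<in>B. sgn (b x) = sgn (b y)) \<longrightarrow> T x = T y"
    using assms(2) unfolding semialgebraic_def by blast
  show ?thesis
  proof (rule semialgebraicI[of "A \<union> B"])
    fix x y assume "\<And>b. b \<in> A \<union> B \<Longrightarrow> sgn (b x) = sgn (b y)"
    then have "S x = S y" "T x = T y" using A(3) B(3) by simp_all
    then show "(S x \<and> T x) = (S y \<and> T y)" by simp
  qed (use A B in auto)
qed

lemma semialgebraic_imp:
  assumes "semialgebraic S" "semialgebraic T"
  shows "semialgebraic (\<lambda>x. S x \<longrightarrow> T x)"
  using semialgebraic_not[OF semialgebraic_conj[OF assms(1) semialgebraic_not[OF assms(2)]]] by simp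

lemma semialgebraic_ball:
  "finite I \<Longrightarrow> (\<And>i. i \<in> I \<Longrightarrow> semialgebraic (S i)) \<Longrightarrow> semialgebraic (\<lambda>x. \<forall>i\<in>I. S i x)"
  by (induction I rule: finite_induct) (simp_all add: semialgebraic_const semialgebraic_conj)

lemma semialgebraic_abs_le:
  assumes "f \<in> polyfuns" "g \<in> polyfuns"
  shows "semialgebraic (\<lambda>x. \<bar>f x\<bar> \<le> g x)"
proof -
  have m: "(\<lambda>x. - f x) \<in> polyfuns"
    using polyfuns_diff[OF polyfuns_const[of 0] assms(1)] by simp
  show ?thesis
    unfolding abs_le_iff by (rule semialgebraic_conj[OF semialgebraic_le[OF assms] semialgebraic_le[OF m assms(2)]])
qed

section \<open>Quantifier elimination\<close>

text \<open>The degree in \<open>t\<close> must be bounded uniformly in the remaining variables; the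
  formal degree records this bound through sums and products.\<close>

lemma polyfuns_fun_upd:
  assumes "b \<in> polyfuns"
  shows "\<exists>P\<in>fpolys. \<forall>x t. b (x(i := t)) = poly (snd P x) t"
  using assms
proof (induction b)
  case (polyfuns_const c)
  have "(0, \<lambda>_. [:c:]) \<in> fpolys"
    by (rule fpolysI) (simp_all add: polyfuns.polyfuns_const)
  then show ?case by (intro bexI[of _ "(0, \<lambda>_. [:c:])"]) simp_all
next
  case (polyfuns_var v)
  show ?case
  proof (cases "v = i")
    case True
    have "(1, \<lambda>_. [:0, 1:]) \<in> fpolys"
      by (rule fpolysI) (simp_all add: polyfuns.polyfuns_const)
    then show ?thesis using True by (intro bexI[of _ "(1, \<lambda>_. [:0, 1:])"]) simp_all
  next
    case False
    have "(\<lambda>x. coeff [:x v:] j) \<in> polyfuns" for j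
      by (cases j) (simp_all add: polyfuns.polyfuns_const polyfuns.polyfuns_var)
    then have "(0, \<lambda>x. [:x v:]) \<in> fpolys" by (intro fpolysI) simp_all
    then show ?thesis using False by (intro bexI[of _ "(0, \<lambda>x. [:x v:])"]) simp_all
  qed
next
  case (polyfuns_add f g)
  then obtain P Q where PQ: "P \<in> fpolys" "Q \<in> fpolys"
    "\<And>x t. f (x(i := t)) = poly (snd P x) t" "\<And>x t. g (x(i := t)) = poly (snd Q x) t" by blast
  obtain n p m q where nm: "P = (n, p)" "Q = (m, q)" by (cases P, cases Q)
  note P = PQ[unfolded nm snd_conv]
  note D = fpolysD[OF P(1), simplified] fpolysD[OF P(2), simplified]
  have "(max n m, \<lambda>x. p x + q x) \<in> fpolys"
  proof (rule fpolysI)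
    show "degree (p x + q x) \<le> max n m" for x
      using D(1)[of x] D(3)[of x] by (intro degree_add_le) auto
    show "(\<lambda>x. coeff (p x + q x) j) \<in> polyfuns" for j
      unfolding coeff_add by (intro polyfuns.polyfuns_add D)
  qed
  then show ?case using P(3,4) by (intro bexI[of _ "(max n m, \<lambda>x. p x + q x)"]) (simp_all del: fun_upd_apply)
next
  case (polyfuns_mult f g)
  then obtain P Q where PQ: "P \<in> fpolys" "Q \<in> fpolys"
    "\<And>x t. f (x(i := t)) = poly (snd P x) t" "\<And>x t. g (x(i := t)) = poly (snd Q x) t" by blast
  obtain n p m q where nm: "P = (n, p)" "Q = (m, q)" by (cases P, cases Q)
  note P = PQ[unfolded nm snd_conv]
  note D = fpolysD[OF P(1), simplified] fpolysD[OF P(2), simplified]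
  have "(n + m, \<lambda>x. p x * q x) \<in> fpolys"
  proof (rule fpolysI)
    show "degree (p x * q x) \<le> n + m" for x
      using degree_mult_le[of "p x" "q x"] D(1)[of x] D(3)[of x] by linarith
    show "(\<lambda>x. coeff (p x * q x) j) \<in> polyfuns" for j
      unfolding coeff_mult by (intro polyfuns_sum polyfuns.polyfuns_mult D)
  qed
  then show ?case using P(3,4) by (intro bexI[of _ "(n + m, \<lambda>x. p x * q x)"]) (simp_all del: fun_upd_apply)
qed

text \<open>If the deciding signs agree at \<open>x\<close> and \<open>y\<close>, the map
  \<open>h\<close> sends a witness \<open>t\<close> over \<open>x\<close> to a point
  \<open>h t\<close> over \<open>y\<close> at which every polynomial deciding \<open>S\<close> has
  the same sign, so \<open>h t\<close> is a witness too. The converse follows by exchanging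
  \<open>x\<close> and \<open>y\<close>.\<close>

theorem tarski_seidenberg:
  assumes "semialgebraic S"
  shows "semialgebraic (\<lambda>x. \<exists>t. S (x(i := t)))"
proof -
  obtain A where A: "finite A" "A \<subseteq> polyfuns" "\<forall>x y. (\<forall>b\<in>A. sgn (b x) = sgn (b y)) \<longrightarrow> S x = S y"
    using assms unfolding semialgebraic_def by blast
  have "\<forall>b\<in>A. \<exists>P. P \<in> fpolys \<and> (\<forall>x t. b (x(i := t)) = poly (snd P x) t)"
    using A(2) polyfuns_fun_upd[of _ i] unfolding Bex_def by (simp add: subset_iff)
  from bchoice[OF this] obtain P where P: "\<And>b. b \<in> A \<Longrightarrow> P b \<in> fpolys"
    "\<And>b x t. b \<in> A \<Longrightarrow> b (x(i := t)) = poly (snd (P b) x) t"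
    by auto
  have PA: "P ` A \<subseteq> fpolys" using P(1) by auto
  obtain B where B: "finite B" "B \<subseteq> polyfuns" "\<forall>x y. (\<forall>b\<in>B. sgn (b x) = sgn (b y)) \<longrightarrow>
      (\<exists>h. \<forall>p\<in>P ` A. same_signs h (snd p x) (snd p y))"
    using sign_determined[OF finite_imageI[OF A(1)] PA]
    by (elim exE conjE) (rule that)
  have imp: "\<exists>t. S (y(i := t))" if s: "\<forall>b\<in>B. sgn (b x) = sgn (b y)" and t: "S (x(i := t))" for x y t
  proof -
    obtain h where "\<forall>p\<in>P ` A. same_signs h (snd p x) (snd p y)" using B(3) s by blast
    then have "sgn (b (x(i := t))) = sgn (b (y(i := h t)))" if "b \<in> A" for b
      using that P(2)[OF that] by (simp add: same_signs_def)
    then have "S (y(i := h t))" using A(3) t by blast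
    then show ?thesis by blast
  qed
  show ?thesis
  proof (rule semialgebraicI[OF B(1,2)])
    fix x y assume s: "\<And>b. b \<in> B \<Longrightarrow> sgn (b x) = sgn (b y)"
    show "(\<exists>t. S (x(i := t))) = (\<exists>t. S (y(i := t)))"
      using imp[of x y] imp[of y x] s by auto
  qed
qed

lemma semialgebraic_ex_finite:
  assumes "finite V" "semialgebraic S"
  shows "semialgebraic (\<lambda>x. \<exists>g. S (\<lambda>v. if v \<in> V then g v else x v))"
  using assms
proof (induction V arbitrary: S rule: finite_induct)
  case empty
  then show ?case by simp
next
  case (insert i V)
  have "(\<exists>g. S (\<lambda>v. if v \<in> insert i V then g v else x v)) \<longleftrightarrow>
    (\<exists>g t. S ((\<lambda>v. if v \<in> V then g v else x v)(i := t)))" for x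
  proof
    assume "\<exists>g. S (\<lambda>v. if v \<in> insert i V then g v else x v)"
    then obtain g where g: "S (\<lambda>v. if v \<in> insert i V then g v else x v)" by blast
    have "(\<lambda>v. if v \<in> insert i V then g v else x v) = (\<lambda>v. if v \<in> V then g v else x v)(i := g i)"
      by auto
    then show "\<exists>g t. S ((\<lambda>v. if v \<in> V then g v else x v)(i := t))" using g by metis
  next
    assume "\<exists>g t. S ((\<lambda>v. if v \<in> V then g v else x v)(i := t))"
    then obtain g t where g: "S ((\<lambda>v. if v \<in> V then g v else x v)(i := t))" by blast
    have "(\<lambda>v. if v \<in> V then g v else x v)(i := t) = (\<lambda>v. if v \<in> insert i V then (g(i := t)) v else x v)"
      using insert.hyps by auto
    then show "\<exists>g. S (\<lambda>v. if v \<in> insert i V then g v else x v)" using g by metis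
  qed
  then show ?case using insert.IH[OF tarski_seidenberg[OF insert.prems, of i]] by (simp del: fun_upd_apply)
qed

lemma polyfuns_subst:
  assumes "f \<in> polyfuns" "\<And>v. g v \<in> polyfuns"
  shows "(\<lambda>x. f (\<lambda>v. g v x)) \<in> polyfuns"
  using assms(1)
  by induction (simp_all add: assms(2) polyfuns.intros)

lemma semialgebraic_subst:
  assumes "semialgebraic S" "\<And>v. g v \<in> polyfuns"
  shows "semialgebraic (\<lambda>x. S (\<lambda>v. g v x))"
proof -
  obtain B where B: "finite B" "B \<subseteq> polyfuns" "\<forall>x y. (\<forall>b\<in>B. sgn (b x) = sgn (b y)) \<longrightarrow> S x = S y"
    using assms(1) unfolding semialgebraic_def by blast
  show ?thesis
  proof (rule semialgebraicI[of "(\<lambda>b x. b (\<lambda>v. g v x)) ` B"])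
    show "(\<lambda>b x. b (\<lambda>v. g v x)) ` B \<subseteq> polyfuns"
    proof (rule image_subsetI)
      fix b assume "b \<in> B"
      then show "(\<lambda>x. b (\<lambda>v. g v x)) \<in> polyfuns"
        by (rule polyfuns_subst[OF subsetD[OF B(2)] assms(2)])
    qed
    fix x y assume *: "\<And>b. b \<in> (\<lambda>b x. b (\<lambda>v. g v x)) ` B \<Longrightarrow> sgn (b x) = sgn (b y)"
    have "sgn (b (\<lambda>v. g v x)) = sgn (b (\<lambda>v. g v y))" if "b \<in> B" for b
      using *[OF imageI[OF that]] .
    then show "S (\<lambda>v. g v x) = S (\<lambda>v. g v y)" using B(3) by simp
  qed (use B(1) in simp)
qed

text \<open>A copy of the space of real vectors indexed by \<open>I\<close> inside functions on a
  possibly infinite type. For finite \<open>I\<close>, quantifying over it amounts to finitely many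
  real quantifiers.\<close>

definition coords :: "'b set \<Rightarrow> ('b \<Rightarrow> real) set" where
  "coords I = {w. \<forall>b. b \<notin> I \<longrightarrow> w b = 0}"

text \<open>Free and bound variables occupy the two summands of a sum type. After elimination no
  bound variable in \<open>Inr\<close> followed by an index of \<open>I\<close> matters, and the
  other bound ones are set to 0, so the result is a predicate of the free variables alone.\<close>

lemma semialgebraic_bex:
  fixes S :: "('a \<Rightarrow> real) \<Rightarrow> ('b \<Rightarrow> real) \<Rightarrow> bool"
  assumes "finite I" "semialgebraic (\<lambda>y :: 'a + 'b \<Rightarrow> real. S (\<lambda>a. y (Inl a)) (\<lambda>b. y (Inr b)))"
  shows "semialgebraic (\<lambda>x. \<exists>w\<in>coords I. S x w)"
proof -
  let ?S = "\<lambda>y :: 'a + 'b \<Rightarrow> real. S (\<lambda>a. y (Inl a)) (\<lambda>b. y (Inr b))"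
  let ?e = "\<lambda>v x. case_sum x (\<lambda>_. 0 :: real) v"
  have e: "?e v \<in> polyfuns" for v :: "'a + 'b"
    by (cases v) (simp_all add: polyfuns_const polyfuns_var)
  have "semialgebraic (\<lambda>x. \<exists>g. ?S (\<lambda>v. if v \<in> Inr ` I then g v else ?e v x))"
    by (rule semialgebraic_subst[OF semialgebraic_ex_finite[OF finite_imageI[OF assms(1)] assms(2)] e])
  also have "(\<lambda>x. \<exists>g. ?S (\<lambda>v. if v \<in> Inr ` I then g v else ?e v x)) = (\<lambda>x. \<exists>w\<in>coords I. S x w)"
  proof
    fix x
    have eq: "?S (\<lambda>v. if v \<in> Inr ` I then g v else ?e v x) = S x (\<lambda>b. if b \<in> I then g (Inr b) else 0)" for g
      by (rule arg_cong2[where f = S]) auto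
    show "(\<exists>g. ?S (\<lambda>v. if v \<in> Inr ` I then g v else ?e v x)) = (\<exists>w\<in>coords I. S x w)"
      unfolding eq
    proof
      assume "\<exists>g :: 'a + 'b \<Rightarrow> real. S x (\<lambda>b. if b \<in> I then g (Inr b) else 0)"
      then obtain g :: "'a + 'b \<Rightarrow> real" where "S x (\<lambda>b. if b \<in> I then g (Inr b) else 0)" by blast
      moreover have "(\<lambda>b. if b \<in> I then g (Inr b) else 0) \<in> coords I" by (simp add: coords_def)
      ultimately show "\<exists>w\<in>coords I. S x w" by (rule bexI)
    next
      assume "\<exists>w\<in>coords I. S x w"
      then obtain w where w: "w \<in> coords I" "S x w" by blast
      have "(\<lambda>b. if b \<in> I then case_sum (\<lambda>_. 0) w (Inr b :: 'a + 'b) else 0) = w"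
        using w(1) by (auto simp: coords_def)
      then show "\<exists>g :: 'a + 'b \<Rightarrow> real. S x (\<lambda>b. if b \<in> I then g (Inr b) else 0)"
        using w(2) by (intro exI[of _ "case_sum (\<lambda>_. 0) w"]) (simp only:)
    qed
  qed
  finally show ?thesis .
qed

lemma semialgebraic_ball_coords:
  fixes S :: "('a \<Rightarrow> real) \<Rightarrow> ('b \<Rightarrow> real) \<Rightarrow> bool"
  assumes "finite I" "semialgebraic (\<lambda>y :: 'a + 'b \<Rightarrow> real. S (\<lambda>a. y (Inl a)) (\<lambda>b. y (Inr b)))"
  shows "semialgebraic (\<lambda>x. \<forall>w\<in>coords I. S x w)"
  using semialgebraic_not[OF semialgebraic_bex[OF assms(1) semialgebraic_not[OF assms(2)]]] by simp

lemma semialgebraic_all: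
  fixes S :: "('a \<Rightarrow> real) \<Rightarrow> ('b :: finite \<Rightarrow> real) \<Rightarrow> bool"
  assumes "semialgebraic (\<lambda>y :: 'a + 'b \<Rightarrow> real. S (\<lambda>a. y (Inl a)) (\<lambda>b. y (Inr b)))"
  shows "semialgebraic (\<lambda>x. \<forall>w. S x w)"
  using semialgebraic_ball_coords[of UNIV, OF _ assms] by (simp add: coords_def)

section \<open>Continuity and boundedness of polynomial functions\<close>

lemma polyfuns_tendsto:
  assumes "f \<in> polyfuns" "\<And>v. (\<lambda>n. X n v) \<longlonglongrightarrow> x v"
  shows "(\<lambda>n. f (X n)) \<longlonglongrightarrow> f x"
  using assms(1) by induction (auto intro: tendsto_add tendsto_mult assms(2))

lemma polyfuns_bounded:
  fixes W :: real
  assumes "f \<in> polyfuns"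
  shows "\<exists>C. \<forall>x. (\<forall>v. \<bar>x v\<bar> \<le> W) \<longrightarrow> \<bar>f x\<bar> \<le> C"
  using assms
proof induction
  case (polyfuns_const c)
  show ?case by (rule exI[of _ "\<bar>c\<bar>"]) simp
next
  case (polyfuns_var v)
  show ?case by (rule exI[of _ W]) simp
next
  case (polyfuns_add f g)
  then obtain A B where "\<And>x. \<forall>v. \<bar>x v\<bar> \<le> W \<Longrightarrow> \<bar>f x\<bar> \<le> A" "\<And>x. \<forall>v. \<bar>x v\<bar> \<le> W \<Longrightarrow> \<bar>g x\<bar> \<le> B" by blast
  then have "\<bar>f x + g x\<bar> \<le> A + B" if "\<forall>v. \<bar>x v\<bar> \<le> W" for x
    using that by (intro order_trans[OF abs_triangle_ineq] add_mono) simp_all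
  then show ?case by blast
next
  case (polyfuns_mult f g)
  then obtain A B where AB: "\<And>x. \<forall>v. \<bar>x v\<bar> \<le> W \<Longrightarrow> \<bar>f x\<bar> \<le> A" "\<And>x. \<forall>v. \<bar>x v\<bar> \<le> W \<Longrightarrow> \<bar>g x\<bar> \<le> B" by blast
  have "\<bar>f x * g x\<bar> \<le> \<bar>A\<bar> * \<bar>B\<bar>" if "\<forall>v. \<bar>x v\<bar> \<le> W" for x
    unfolding abs_mult using AB[OF that] by (intro mult_mono) simp_all
  then show ?case by blast
qed

subsection \<open>Planar semialgebraic sets near an axis\<close>

lemma poly_bounded_01:
  fixes p :: "real poly"
  shows "\<exists>C\<ge>0. \<forall>t. 0 \<le> t \<longrightarrow> t \<le> 1 \<longrightarrow> \<bar>poly p t\<bar> \<le> C"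
proof (induction p)
  case 0
  show ?case by (rule exI[of _ 0]) simp
next
  case (pCons a p)
  then obtain C where C: "C \<ge> 0" "\<And>t. 0 \<le> t \<Longrightarrow> t \<le> 1 \<Longrightarrow> \<bar>poly p t\<bar> \<le> C" by blast
  have "\<bar>poly (pCons a p) t\<bar> \<le> \<bar>a\<bar> + C" if "0 \<le> t" "t \<le> 1" for t
  proof -
    have "\<bar>t * poly p t\<bar> \<le> 1 * C" unfolding abs_mult using that C by (intro mult_mono) auto
    then show ?thesis by simp
  qed
  then show ?case using C(1) by (intro exI[of _ "\<bar>a\<bar> + C"]) auto
qed

text \<open>A polynomial in two variables is stored as a polynomial in \<open>s\<close> with
  coefficients in \<open>t\<close>; \<open>poly (poly p [:s:]) t\<close> is its value.\<close>

lemma poly_poly_bounded_01: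
  fixes p :: "real poly poly"
  shows "\<exists>C\<ge>0. \<forall>t s. 0 \<le> t \<longrightarrow> t \<le> 1 \<longrightarrow> 0 \<le> s \<longrightarrow> s \<le> 1 \<longrightarrow> \<bar>poly (poly p [:s:]) t\<bar> \<le> C"
proof (induction p)
  case 0
  show ?case by (rule exI[of _ 0]) simp
next
  case (pCons a p)
  then obtain C where C: "C \<ge> 0"
    "\<And>t s. 0 \<le> t \<Longrightarrow> t \<le> 1 \<Longrightarrow> 0 \<le> s \<Longrightarrow> s \<le> 1 \<Longrightarrow> \<bar>poly (poly p [:s:]) t\<bar> \<le> C" by blast
  obtain A where A: "A \<ge> 0" "\<And>t. 0 \<le> t \<Longrightarrow> t \<le> 1 \<Longrightarrow> \<bar>poly a t\<bar> \<le> A" using poly_bounded_01 by blast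
  have "\<bar>poly (poly (pCons a p) [:s:]) t\<bar> \<le> A + C" if "0 \<le> t" "t \<le> 1" "0 \<le> s" "s \<le> 1" for t s
  proof -
    have "\<bar>s * poly (poly p [:s:]) t\<bar> \<le> 1 * C" unfolding abs_mult using that C by (intro mult_mono) auto
    then show ?thesis using A(2)[OF that(1,2)] by simp
  qed
  then show ?case using A C(1) by (intro exI[of _ "A + C"]) auto
qed

text \<open>The exponent is the order of vanishing at 0. The cofactor does not vanish at 0, so by
  continuity it stays above half its absolute value there.\<close>

lemma poly_lower_bound_near_0:
  fixes a :: "real poly"
  assumes "a \<noteq> 0"
  shows "\<exists>c>0. \<exists>l. \<exists>t0>0. \<forall>t. 0 < t \<longrightarrow> t < t0 \<longrightarrow> c * t ^ l \<le> \<bar>poly a t\<bar>"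
proof -
  obtain q where q: "a = [:- 0, 1:] ^ order 0 a * q" "\<not> [:- 0, 1:] dvd q"
    using order_decomp[OF assms] by blast
  define c where "c = \<bar>poly q 0\<bar> / 2"
  have c: "c > 0" using q(2) by (simp add: c_def poly_eq_0_iff_dvd)
  have "(poly q \<longlongrightarrow> poly q 0) (at 0)" by (intro isContD) simp
  then have "eventually (\<lambda>t. dist (poly q t) (poly q 0) < c) (at 0)" using c by (rule tendstoD)
  then obtain t0 where t0: "t0 > 0" "\<And>t. t \<noteq> 0 \<Longrightarrow> dist t 0 < t0 \<Longrightarrow> dist (poly q t) (poly q 0) < c"
    unfolding eventually_at by blast
  have "c * t ^ order 0 a \<le> \<bar>poly a t\<bar>" if t: "0 < t" "t < t0" for t
  proof -
    have "c \<le> \<bar>poly q t\<bar>" using t0(2)[of t] t unfolding c_def dist_real_def by arith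
    moreover have "\<bar>poly a t\<bar> = t ^ order 0 a * \<bar>poly q t\<bar>"
      using t by (subst q(1)) (simp add: abs_mult)
    ultimately show ?thesis using t by (simp add: mult.commute mult_left_mono)
  qed
  then show ?thesis using c t0(1) by blast
qed

lemma poly_poly_slice:
  fixes p :: "real poly poly"
  shows "\<exists>r. \<forall>s. poly r s = poly (poly p [:s:]) t"
proof (induction p)
  case (pCons a p)
  then obtain r where "\<And>s. poly r s = poly (poly p [:s:]) t" by blast
  then show ?case by (intro exI[of _ "pCons (poly a t) r"]) simp
qed (intro exI[of _ 0], simp)

text \<open>After division by the largest power of \<open>s\<close>, which is positive, the value is
  \<open>a\<close> at \<open>t\<close> plus \<open>s\<close> times a bounded term, with
  \<open>a\<close> a nonzero polynomial in \<open>t\<close> alone. The first summand is at least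
  \<open>c * t ^ l\<close>, so it dominates when \<open>s\<close> is below a small multiple of
  \<open>t ^ l\<close>.\<close>

lemma poly_poly_nonzero_near_0:
  fixes p :: "real poly poly"
  assumes "p \<noteq> 0"
  shows "\<exists>c>0. \<exists>l. \<exists>t0>0. \<forall>t s. 0 < t \<longrightarrow> t < t0 \<longrightarrow> 0 < s \<longrightarrow> s < c * t ^ l \<longrightarrow> poly (poly p [:s:]) t \<noteq> 0"
proof -
  obtain q where q: "p = [:- 0, 1:] ^ order 0 p * q" "\<not> [:- 0, 1:] dvd q"
    using order_decomp[OF assms] by blast
  obtain a r where ar: "q = pCons a r" by (cases q)
  have a: "a \<noteq> 0" using q(2) by (auto simp: ar dvd_def)
  obtain c l t0 where c: "c > 0" "t0 > 0" "\<And>t. 0 < t \<Longrightarrow> t < t0 \<Longrightarrow> c * t ^ l \<le> \<bar>poly a t\<bar>"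
    using poly_lower_bound_near_0[OF a] by blast
  obtain C where C: "C \<ge> 0"
    "\<And>t s. 0 \<le> t \<Longrightarrow> t \<le> 1 \<Longrightarrow> 0 \<le> s \<Longrightarrow> s \<le> 1 \<Longrightarrow> \<bar>poly (poly r [:s:]) t\<bar> \<le> C"
    using poly_poly_bounded_01 by blast
  \<comment> \<open>\<open>C + 1\<close> avoids division by zero, and the bound 1 keeps
    \<open>s\<close> in the unit interval, where the estimate for \<open>r\<close> is valid.\<close>
  define c' where "c' = min 1 (c / (C + 1))"
  have c': "c' > 0" "c' \<le> 1" using c(1) C(1) by (auto simp: c'_def)
  have "c' * (C + 1) \<le> c / (C + 1) * (C + 1)"
    using C(1) by (intro mult_right_mono) (auto simp: c'_def)
  then have c'C: "c' * (C + 1) \<le> c" using C(1) by simp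
  have "poly (poly p [:s:]) t \<noteq> 0" if t: "0 < t" "t < min 1 t0" and s: "0 < s" "s < c' * t ^ l" for t s
  proof
    assume z: "poly (poly p [:s:]) t = 0"
    have "t ^ l \<le> 1" using t by (intro power_le_one) auto
    then have s1: "s \<le> 1" using s(2) c' mult_mono[of c' 1 "t ^ l" 1] t by auto
    have "poly (poly p [:s:]) t = s ^ order 0 p * (poly a t + s * poly (poly r [:s:]) t)"
      by (subst q(1)) (simp add: ar poly_power algebra_simps)
    then have "\<bar>poly a t\<bar> = \<bar>s * poly (poly r [:s:]) t\<bar>" using z s by auto
    also have "\<dots> \<le> s * C" using C(2)[of t s] t s s1 by (simp add: abs_mult)
    also have "\<dots> \<le> s * (C + 1)" using s by simp
    also have "\<dots> < c' * t ^ l * (C + 1)" using s C(1) by (intro mult_strict_right_mono) auto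
    also have "\<dots> = c' * (C + 1) * t ^ l" by simp
    also have "\<dots> \<le> c * t ^ l" using c'C t by (intro mult_right_mono) auto
    finally show False using c(3)[of t] t by simp
  qed
  then show ?thesis using c'(1) c(2) by (intro exI[of _ c'] conjI exI[of _ l] exI[of _ "min 1 t0"]) auto
qed

lemma poly_poly_nonzero_near_0_finite:
  fixes P :: "real poly poly set"
  assumes "finite P" "0 \<notin> P"
  shows "\<exists>c>0. \<exists>l. \<exists>t0>0. \<forall>t s. 0 < t \<longrightarrow> t < t0 \<longrightarrow> 0 < s \<longrightarrow> s < c * t ^ l \<longrightarrow>
    (\<forall>p\<in>P. poly (poly p [:s:]) t \<noteq> 0)"
  using assms
proof (induction P rule: finite_induct)
  case empty
  show ?case by (simp add: gt_ex)
next
  case (insert p P)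
  obtain c l t0 where 1: "c > 0" "t0 > 0"
    "\<And>t s. 0 < t \<Longrightarrow> t < t0 \<Longrightarrow> 0 < s \<Longrightarrow> s < c * t ^ l \<Longrightarrow> (\<forall>p\<in>P. poly (poly p [:s:]) t \<noteq> 0)"
    using insert.IH insert.prems by blast
  have "p \<noteq> 0" using insert.prems by auto
  then obtain c' l' t0' where 2: "c' > 0" "t0' > 0"
    "\<And>t s. 0 < t \<Longrightarrow> t < t0' \<Longrightarrow> 0 < s \<Longrightarrow> s < c' * t ^ l' \<Longrightarrow> poly (poly p [:s:]) t \<noteq> 0"
    using poly_poly_nonzero_near_0[of p] by blast
  have "\<forall>p\<in>insert p P. poly (poly p [:s:]) t \<noteq> 0"
    if t: "0 < t" "t < min 1 (min t0 t0')" and s: "0 < s" "s < min c c' * t ^ max l l'" for t s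
  proof -
    \<comment> \<open>Since \<open>t < 1\<close>, the larger exponent gives the smaller
      region.\<close>
    have "min c c' * t ^ max l l' \<le> c * t ^ l" "min c c' * t ^ max l l' \<le> c' * t ^ l'"
      using t 1(1) 2(1) by (auto intro!: mult_mono power_decreasing)
    then show ?thesis using 1(3)[of t s] 2(3)[of t s] t s by auto
  qed
  then show ?case using 1(1,2) 2(1,2)
    by (intro exI[of _ "min c c'"] conjI exI[of _ "max l l'"] exI[of _ "min 1 (min t0 t0')"]) auto
qed

lemma polyfuns_two_vars:
  assumes "b \<in> polyfuns" "u \<noteq> w"
  shows "\<exists>p. \<forall>t s. b (x(u := t, w := s)) = poly (poly p [:s:]) t"
  using assms(1)
proof induction
  case (polyfuns_const c)
  show ?case by (rule exI[of _ "[:[:c:]:]"]) simp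
next
  case (polyfuns_var v)
  consider "v = u" | "v = w" | "v \<noteq> u" "v \<noteq> w" by blast
  then show ?case
  proof cases
    case 1
    then show ?thesis using assms(2) by (intro exI[of _ "[:[:0, 1:]:]"]) simp
  next
    case 2
    then show ?thesis by (intro exI[of _ "[:0, 1:]"]) simp
  next
    case 3
    then show ?thesis by (intro exI[of _ "[:[:x v:]:]"]) simp
  qed
next
  case (polyfuns_add f g)
  then obtain p q where "\<And>t s. f (x(u := t, w := s)) = poly (poly p [:s:]) t"
    "\<And>t s. g (x(u := t, w := s)) = poly (poly q [:s:]) t" by blast
  then show ?case by (intro exI[of _ "p + q"]) (simp del: fun_upd_apply)
next
  case (polyfuns_mult f g)
  then obtain p q where "\<And>t s. f (x(u := t, w := s)) = poly (poly p [:s:]) t"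
    "\<And>t s. g (x(u := t, w := s)) = poly (poly q [:s:]) t" by blast
  then show ?case by (intro exI[of _ "p * q"]) (simp del: fun_upd_apply)
qed

text \<open>The nonzero defining polynomials have no zero in the region \<open>0 < s < c t\<^sup>l\<close>, so on each
  of its vertical segments \<open>S\<close> is constant.\<close>

theorem semialgebraic_growth:
  fixes S :: "('v \<Rightarrow> real) \<Rightarrow> bool"
  assumes S: "semialgebraic S" and "u \<noteq> w"
    and pos: "\<And>t. 0 < t \<Longrightarrow> \<exists>s0>0. \<forall>s. 0 < s \<longrightarrow> s < s0 \<longrightarrow> \<not> S (x(u := t, w := s))"
  shows "\<exists>c>0. \<exists>l. \<exists>t0>0. \<forall>t s. 0 < t \<longrightarrow> t < t0 \<longrightarrow> 0 < s \<longrightarrow> s < c * t ^ l \<longrightarrow> \<not> S (x(u := t, w := s))"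
proof -
  obtain B where B: "finite B" "B \<subseteq> polyfuns" "\<forall>x y. (\<forall>b\<in>B. sgn (b x) = sgn (b y)) \<longrightarrow> S x = S y"
    using S unfolding semialgebraic_def by blast
  have "\<forall>b\<in>B. \<exists>p. \<forall>t s. b (x(u := t, w := s)) = poly (poly p [:s:]) t"
    using polyfuns_two_vars[OF _ assms(2)] B(2) by blast
  from bchoice[OF this] obtain P where
    P: "\<forall>b\<in>B. \<forall>t s. b (x(u := t, w := s)) = poly (poly (P b) [:s:]) t" by blast
  obtain c l t0 where c: "c > 0" "t0 > 0"
    "\<forall>t s. 0 < t \<longrightarrow> t < t0 \<longrightarrow> 0 < s \<longrightarrow> s < c * t ^ l \<longrightarrow> (\<forall>p\<in>P ` B - {0}. poly (poly p [:s:]) t \<noteq> 0)"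
    using poly_poly_nonzero_near_0_finite[of "P ` B - {0}"] B(1) by auto
  have "\<not> S (x(u := t, w := s))" if t: "0 < t" "t < t0" and s: "0 < s" "s < c * t ^ l" for t s
  proof
    assume St: "S (x(u := t, w := s))"
    obtain s0 where s0: "s0 > 0" "\<And>s. 0 < s \<Longrightarrow> s < s0 \<Longrightarrow> \<not> S (x(u := t, w := s))"
      using pos[OF t(1)] by blast
    \<comment> \<open>A lower point of the same vertical segment, low enough for \<open>pos\<close>
      to apply; the truth value of \<open>S\<close> is compared between \<open>s\<close> and
      \<open>s'\<close>.\<close>
    define s' where "s' = min s (s0 / 2)"
    have s': "0 < s'" "s' < s0" "s' \<le> s" using s0(1) s(1) by (auto simp: s'_def)
    have "sgn (b (x(u := t, w := s))) = sgn (b (x(u := t, w := s')))" if b: "b \<in> B" for b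
    proof -
      obtain r where r: "\<And>y. poly r y = poly (poly (P b) [:y:]) t"
        using poly_poly_slice by blast
      have "sgn (poly r s') = sgn (poly r s)"
      proof (cases "P b = 0")
        case False
        show ?thesis
        proof (rule sgn_poly_eq_if_no_root[OF s'(3)])
          fix y assume "s' \<le> y" "y \<le> s"
          then show "poly r y \<noteq> 0" unfolding r using c(3) t s s' b False by auto
        qed
      qed (simp add: r)
      moreover have "b (x(u := t, w := y)) = poly r y" for y
        unfolding r using P b by blast
      ultimately show ?thesis by metis
    qed
    then have "S (x(u := t, w := s'))" using B(3) St by blast
    then show False using s0(2) s' by blast
  qed
  then show ?thesis using c(1,2) by blast
qed

subsection \<open>Bounded families of polynomials\<close>

definition exponents :: "nat \<Rightarrow> ('k::finite \<Rightarrow>\<^sub>0 nat) set" where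
  "exponents d = {e. (\<Sum>i\<in>UNIV. Poly_Mapping.lookup e i) \<le> d}"

definition power_product :: "('k::finite \<Rightarrow>\<^sub>0 nat) \<Rightarrow> ('k \<Rightarrow> real) \<Rightarrow> real" where
  "power_product e z = (\<Prod>v\<in>UNIV. z v ^ Poly_Mapping.lookup e v)"

definition poly_val :: "nat \<Rightarrow> (('k::finite \<Rightarrow>\<^sub>0 nat) \<Rightarrow> real) \<Rightarrow> ('k \<Rightarrow> real) \<Rightarrow> real" where
  "poly_val d c z = (\<Sum>e\<in>exponents d. c e * power_product e z)"

text \<open>The cube with points as functions of the coordinate, the form in which they can be
  variables of \<open>polyfuns\<close>.\<close>

definition unit_box :: "('k \<Rightarrow> real) set" where
  "unit_box = {z. \<forall>v. \<bar>z v\<bar> \<le> 1}"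

lemma exponents_lookup_le:
  assumes "e \<in> exponents d"
  shows "Poly_Mapping.lookup e v \<le> d"
proof -
  have "Poly_Mapping.lookup e v \<le> (\<Sum>i\<in>UNIV. Poly_Mapping.lookup e i)"
    by (rule member_le_sum) auto
  then show ?thesis using assms by (simp add: exponents_def)
qed

lemma finite_exponents: "finite (exponents d :: ('k::finite \<Rightarrow>\<^sub>0 nat) set)"
proof (rule finite_imageD)
  have "Poly_Mapping.lookup ` exponents d \<subseteq> PiE (UNIV :: 'k set) (\<lambda>_. {..d})"
    using exponents_lookup_le by auto
  moreover have "finite (PiE (UNIV :: 'k set) (\<lambda>_. {..d}))" by (rule finite_PiE) auto
  ultimately show "finite (Poly_Mapping.lookup ` (exponents d :: ('k \<Rightarrow>\<^sub>0 nat) set))"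
    by (rule finite_subset)
  show "inj_on Poly_Mapping.lookup (exponents d :: ('k \<Rightarrow>\<^sub>0 nat) set)"
    by (rule inj_onI) (simp add: lookup_inject)
qed

lemma abs_power_product_le: "z \<in> unit_box \<Longrightarrow> \<bar>power_product e z\<bar> \<le> 1"
  unfolding power_product_def unit_box_def abs_prod power_abs
  by (intro prod_le_1) (auto intro: power_le_one)

lemma poly_val_diff: "poly_val d (\<lambda>e. a e - b e) z = poly_val d a z - poly_val d b z"
  by (simp add: poly_val_def sum_subtractf algebra_simps)

lemma abs_poly_val_le:
  assumes "z \<in> unit_box"
  shows "\<bar>poly_val d c z\<bar> \<le> (\<Sum>e\<in>exponents d. \<bar>c e\<bar>)"
proof -
  have "\<bar>poly_val d c z\<bar> \<le> (\<Sum>e\<in>exponents d. \<bar>c e * power_product e z\<bar>)"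
    unfolding poly_val_def by (rule sum_abs)
  also have "\<dots> \<le> (\<Sum>e\<in>exponents d. \<bar>c e\<bar>)"
    using abs_power_product_le[OF assms] by (intro sum_mono) (auto simp: abs_mult intro: mult_left_le)
  finally show ?thesis .
qed

lemma polyfuns_poly_val:
  assumes "\<And>e. (\<lambda>x. c e x) \<in> polyfuns" "\<And>v. (\<lambda>x. z v x) \<in> polyfuns"
  shows "(\<lambda>x. poly_val d (\<lambda>e. c e x) (\<lambda>v. z v x)) \<in> polyfuns"
  unfolding poly_val_def power_product_def
  by (intro polyfuns_sum polyfuns_mult polyfuns_prod polyfuns_power assms)

text \<open>The weights are the coefficients of the Lagrange basis polynomials, that is, the inverse
  Vandermonde matrix. The interpolant of \<open>t ^ i\<close> at \<open>d + 1\<close> nodes is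
  \<open>t ^ i\<close> itself, as the difference has degree at most \<open>d\<close> and too many
  roots.\<close>

lemma ex_interpolation_weights:
  fixes x :: "nat \<Rightarrow> real"
  assumes "inj_on x {..d}"
  shows "\<exists>\<omega>. \<forall>i\<le>d. \<forall>e\<le>d. (\<Sum>j\<le>d. \<omega> j e * x j ^ i) = (if e = i then 1 else 0)"
proof -
  define L where "L j = (\<Prod>i\<in>{..d} - {j}. smult (1 / (x j - x i)) [:- x i, 1:])" for j
  have L1: "poly (L j) (x j) = 1" if "j \<le> d" for j
  proof -
    have "x j \<noteq> x i" if "i \<in> {..d} - {j}" for i
      using inj_onD[OF assms, of j i] \<open>j \<le> d\<close> that by auto
    then have "poly (smult (1 / (x j - x i)) [:- x i, 1:]) (x j) = 1" if "i \<in> {..d} - {j}" for i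
      using that by (simp flip: diff_divide_distrib add.commute[of "- _"])
    then show ?thesis unfolding L_def poly_prod by (intro prod.neutral) blast
  qed
  have L0: "poly (L j) (x i) = 0" if "i \<le> d" "i \<noteq> j" for i j
    unfolding L_def poly_prod using that by (intro prod_zero) (auto intro!: bexI[of _ i])
  have dL: "degree (L j) \<le> d" if "j \<le> d" for j
  proof -
    have "degree (L j) \<le> (\<Sum>i\<in>{..d} - {j}. degree (smult (1 / (x j - x i)) [:- x i, 1:]))"
      unfolding L_def by (rule degree_prod_sum_le[unfolded o_def]) simp
    also have "\<dots> \<le> (\<Sum>i\<in>{..d} - {j}. 1)" by (intro sum_mono) simp
    also have "\<dots> = d" using that by simp
    finally show ?thesis .
  qed
  have "(\<Sum>j\<le>d. coeff (L j) e * x j ^ i) = (if e = i then 1 else 0)" if "i \<le> d" for i e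
  proof -
    define R where "R = (\<Sum>j\<le>d. smult (x j ^ i) (L j)) - monom 1 i"
    have "R = 0"
    proof (rule ccontr)
      assume n: "R \<noteq> 0"
      have "poly R (x k) = 0" if "k \<le> d" for k
      proof -
        have "(\<Sum>j\<le>d. x j ^ i * poly (L j) (x k)) = (\<Sum>j\<le>d. if j = k then x k ^ i else 0)"
          using that L0[of k] L1 by (intro sum.cong) auto
        then show ?thesis using that by (simp add: R_def poly_sum poly_monom)
      qed
      then have "x ` {..d} \<subseteq> {y. poly R y = 0}" by auto
      then have "card (x ` {..d}) \<le> card {y. poly R y = 0}"
        by (rule card_mono[OF poly_roots_finite[OF n]])
      moreover have "card (x ` {..d}) = d + 1" using card_image[OF assms] by simp
      moreover have "degree R \<le> d" unfolding R_def
        using that dL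
        by (intro degree_diff_le degree_sum_le) (auto intro: degree_smult_le[THEN le_trans] degree_monom_le[THEN le_trans])
      ultimately show False using card_poly_roots_bound[OF n] by simp
    qed
    then have "coeff (\<Sum>j\<le>d. smult (x j ^ i) (L j)) e = coeff (monom 1 i) e" by (simp add: R_def)
    then show ?thesis by (simp add: coeff_sum mult.commute eq_commute[of i e])
  qed
  then show ?thesis by (intro exI[of _ "\<lambda>j e. coeff (L j) e"]) simp
qed

text \<open>In each variable the exponents are at most \<open>d\<close>, so products of the
  one-variable weights recover every coefficient from the values on a grid in the cube.\<close>

lemma coeff_bounded_by_values:
  "\<exists>W. \<forall>c. (\<forall>z\<in>unit_box. \<bar>poly_val d c z\<bar> \<le> 1) \<longrightarrow>
    (\<forall>e\<in>exponents d. \<bar>c (e :: 'k::finite \<Rightarrow>\<^sub>0 nat)\<bar> \<le> W)"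
proof -
  \<comment> \<open>Dividing by \<open>d + 1\<close> instead of \<open>d\<close> also covers
    \<open>d = 0\<close>.\<close>
  define x where "x j = real j / real (d + 1)" for j
  have "inj_on x {..d}" by (auto simp: x_def inj_on_def field_simps)
  then obtain \<omega> where \<omega>: "\<And>i e. i \<le> d \<Longrightarrow> e \<le> d \<Longrightarrow> (\<Sum>j\<le>d. \<omega> j e * x j ^ i) = (if e = i then 1 else 0)"
    using ex_interpolation_weights by blast
  define J where "J = PiE (UNIV :: 'k set) (\<lambda>_. {..d})"
  define \<Omega> where "\<Omega> e j = (\<Prod>v\<in>UNIV. \<omega> (j v) (Poly_Mapping.lookup e v))" for e and j :: "'k \<Rightarrow> nat"
  define pt where "pt j = (\<lambda>v. x (j v))" for j :: "'k \<Rightarrow> nat"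
  have finJ: "finite J" unfolding J_def by (rule finite_PiE) auto
  have orth: "(\<Sum>j\<in>J. \<Omega> e j * power_product e' (pt j)) = (if e = e' then 1 else 0)"
    if e: "e \<in> exponents d" "e' \<in> exponents d" for e e' :: "'k \<Rightarrow>\<^sub>0 nat"
  proof -
    have "(\<Sum>j\<in>J. \<Omega> e j * power_product e' (pt j)) =
      (\<Sum>j\<in>J. \<Prod>v\<in>UNIV. \<omega> (j v) (Poly_Mapping.lookup e v) * x (j v) ^ Poly_Mapping.lookup e' v)"
      by (simp add: \<Omega>_def power_product_def pt_def prod.distrib)
    also have "\<dots> = (\<Prod>v\<in>UNIV. \<Sum>j\<le>d. \<omega> j (Poly_Mapping.lookup e v) * x j ^ Poly_Mapping.lookup e' v)"
      unfolding J_def by (rule prod_sum_PiE[symmetric]) auto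
    also have "\<dots> = (\<Prod>v\<in>UNIV. if Poly_Mapping.lookup e v = Poly_Mapping.lookup e' v then 1 else 0)"
      using e by (intro prod.cong refl \<omega> exponents_lookup_le)
    also have "\<dots> = (if e = e' then 1 else 0)"
    proof (cases "e = e'")
      case False
      then obtain v where "Poly_Mapping.lookup e v \<noteq> Poly_Mapping.lookup e' v"
        by (metis poly_mapping_eqI)
      then have "(\<Prod>v\<in>UNIV. if Poly_Mapping.lookup e v = Poly_Mapping.lookup e' v then 1 else 0) = (0 :: real)"
        by (intro prod_zero) auto
      then show ?thesis using False by simp
    qed simp
    finally show ?thesis .
  qed
  have "\<bar>c e\<bar> \<le> (\<Sum>e\<in>exponents d. \<Sum>j\<in>J. \<bar>\<Omega> e j\<bar>)"
    if c: "\<forall>z\<in>unit_box. \<bar>poly_val d c z\<bar> \<le> 1" and e: "e \<in> exponents d"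
    for c and e :: "'k \<Rightarrow>\<^sub>0 nat"
  proof -
    have "(\<Sum>j\<in>J. \<Omega> e j * poly_val d c (pt j)) =
      (\<Sum>j\<in>J. \<Sum>e'\<in>exponents d. c e' * (\<Omega> e j * power_product e' (pt j)))"
      by (simp add: poly_val_def sum_distrib_left mult_ac)
    also have "\<dots> = (\<Sum>e'\<in>exponents d. c e' * (\<Sum>j\<in>J. \<Omega> e j * power_product e' (pt j)))"
      by (subst sum.swap) (simp add: sum_distrib_left)
    also have "\<dots> = (\<Sum>e'\<in>exponents d. if e' = e then c e' else 0)"
      using orth[OF e] by (intro sum.cong) auto
    also have "\<dots> = c e" using e by (simp add: finite_exponents)
    finally have "\<bar>c e\<bar> = \<bar>\<Sum>j\<in>J. \<Omega> e j * poly_val d c (pt j)\<bar>" by simp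
    also have "\<dots> \<le> (\<Sum>j\<in>J. \<bar>\<Omega> e j * poly_val d c (pt j)\<bar>)" by (rule sum_abs)
    also have "\<dots> \<le> (\<Sum>j\<in>J. \<bar>\<Omega> e j\<bar>)"
    proof (rule sum_mono)
      fix j assume "j \<in> J"
      then have "j v \<le> d" for v by (auto simp: J_def PiE_def)
      then have "real (j v) \<le> 1 + real d" for v by (simp add: of_nat_le_iff[symmetric] add_increasing)
      then have "pt j \<in> unit_box" by (simp add: pt_def x_def unit_box_def)
      then show "\<bar>\<Omega> e j * poly_val d c (pt j)\<bar> \<le> \<bar>\<Omega> e j\<bar>"
        using c by (simp add: abs_mult mult_left_le)
    qed
    also have "\<dots> \<le> (\<Sum>e\<in>exponents d. \<Sum>j\<in>J. \<bar>\<Omega> e j\<bar>)"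
      using e finite_exponents[of d] by (intro member_le_sum) (auto intro: sum_nonneg)
    finally show ?thesis .
  qed
  then show ?thesis by blast
qed

lemma convergent_subseq_finite:
  fixes X :: "nat \<Rightarrow> 'b \<Rightarrow> real"
  assumes "finite I" "\<And>n b. b \<in> I \<Longrightarrow> \<bar>X n b\<bar> \<le> W"
  shows "\<exists>r l. strict_mono r \<and> (\<forall>b\<in>I. (\<lambda>n. X (r n) b) \<longlonglongrightarrow> l b)"
  using assms
proof (induction I rule: finite_induct)
  case empty
  show ?case by (intro exI[of _ "\<lambda>n. n"]) (simp add: strict_mono_def)
next
  case (insert a I)
  then obtain r l where r: "strict_mono r" "\<forall>b\<in>I. (\<lambda>n. X (r n) b) \<longlonglongrightarrow> l b" by auto
  have "bounded (range (\<lambda>n. X (r n) a))"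
    unfolding bounded_iff using insert.prems by (intro exI[of _ W]) auto
  then obtain m r' where r': "strict_mono r'" "((\<lambda>n. X (r n) a) \<circ> r') \<longlonglongrightarrow> m"
    using bounded_imp_convergent_subsequence by blast
  have "(\<lambda>n. X ((r \<circ> r') n) b) \<longlonglongrightarrow> (l(a := m)) b" if "b \<in> insert a I" for b
  proof (cases "b = a")
    case True
    then show ?thesis using r'(2) by (simp add: o_def)
  next
    case False
    then have "(\<lambda>n. X (r n) b) \<longlonglongrightarrow> l b" using r(2) that by auto
    from LIMSEQ_subseq_LIMSEQ[OF this r'(1)] show ?thesis using False by (simp add: o_def)
  qed
  then show ?case using strict_mono_o[OF r(1) r'(1)] by blast
qed

section \<open>The approximation property for coefficient vectors\<close>

text \<open>\<open>cs e w\<close> is the coefficient at \<open>e\<close> of the determinant of the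
  tuple with coefficient vector \<open>w\<close>. Keeping only these functions separates the
  quantitative argument from formal polynomials and graphs.\<close>

locale poly_family =
  fixes d D :: nat and cs :: "('k::finite \<Rightarrow>\<^sub>0 nat) \<Rightarrow> ('m::finite \<times> ('k \<Rightarrow>\<^sub>0 nat) \<Rightarrow> real) \<Rightarrow> real"
  assumes cs: "cs e \<in> polyfuns"
begin

definition idx :: "('m \<times> ('k \<Rightarrow>\<^sub>0 nat)) set" where
  "idx = UNIV \<times> exponents d"

definition val :: "('m \<times> ('k \<Rightarrow>\<^sub>0 nat) \<Rightarrow> real) \<Rightarrow> 'm \<Rightarrow> ('k \<Rightarrow> real) \<Rightarrow> real" where
  "val w i z = poly_val d (\<lambda>e. w (i, e)) z"

definition det_poly :: "('m \<times> ('k \<Rightarrow>\<^sub>0 nat) \<Rightarrow> real) \<Rightarrow> ('k \<Rightarrow> real) \<Rightarrow> real" where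
  "det_poly w z = poly_val D (\<lambda>e. cs e w) z"

definition normal :: "('m \<times> ('k \<Rightarrow>\<^sub>0 nat) \<Rightarrow> real) \<Rightarrow> bool" where
  "normal w \<longleftrightarrow> (\<forall>z\<in>unit_box. \<forall>i. \<bar>val w i z\<bar> \<le> 1)"

text \<open>Vanishing is written as an absolute value at most 0, so that it is an instance of the
  condition in \<open>far\<close> and is covered by the same lemma on semialgebraicity.\<close>

definition degenerate :: "('m \<times> ('k \<Rightarrow>\<^sub>0 nat) \<Rightarrow> real) \<Rightarrow> bool" where
  "degenerate w \<longleftrightarrow> normal w \<and> (\<forall>z\<in>unit_box. \<bar>det_poly w z\<bar> \<le> 0)"

definition close :: "real \<Rightarrow> ('m \<times> ('k \<Rightarrow>\<^sub>0 nat) \<Rightarrow> real) \<Rightarrow> ('m \<times> ('k \<Rightarrow>\<^sub>0 nat) \<Rightarrow> real) \<Rightarrow> bool" where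
  "close t w y \<longleftrightarrow> (\<forall>z\<in>unit_box. \<forall>i. \<bar>val w i z - val y i z\<bar> \<le> t)"

definition far :: "real \<Rightarrow> real \<Rightarrow> bool" where
  "far t s \<longleftrightarrow> (\<exists>w\<in>coords idx. normal w \<and> (\<forall>z\<in>unit_box. \<bar>det_poly w z\<bar> \<le> s) \<and>
     (\<forall>y\<in>coords idx. degenerate y \<longrightarrow> \<not> close t w y))"

lemma finite_idx: "finite idx"
  by (simp add: idx_def finite_exponents)

lemma polyfuns_val:
  assumes "\<And>a. (\<lambda>x. w a x) \<in> polyfuns" "\<And>v. (\<lambda>x. z v x) \<in> polyfuns"
  shows "(\<lambda>x. val (\<lambda>a. w a x) i (\<lambda>v. z v x)) \<in> polyfuns"
  unfolding val_def by (rule polyfuns_poly_val[OF assms])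

lemma polyfuns_det_poly:
  assumes "\<And>a. (\<lambda>x. w a x) \<in> polyfuns" "\<And>v. (\<lambda>x. z v x) \<in> polyfuns"
  shows "(\<lambda>x. det_poly (\<lambda>a. w a x) (\<lambda>v. z v x)) \<in> polyfuns"
  unfolding det_poly_def by (rule polyfuns_poly_val[OF polyfuns_subst[OF cs assms(1)] assms(2)])

lemma semialgebraic_all_unit_box:
  fixes S :: "('a \<Rightarrow> real) \<Rightarrow> ('k \<Rightarrow> real) \<Rightarrow> bool"
  assumes "semialgebraic (\<lambda>y :: 'a + 'k \<Rightarrow> real. S (\<lambda>a. y (Inl a)) (\<lambda>v. y (Inr v)))"
  shows "semialgebraic (\<lambda>x. \<forall>z\<in>unit_box. S x z)"
proof -
  have "semialgebraic (\<lambda>y :: 'a + 'k \<Rightarrow> real. \<forall>v\<in>UNIV. \<bar>y (Inr v)\<bar> \<le> 1)"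
    by (rule semialgebraic_ball[OF finite semialgebraic_abs_le[OF polyfuns_var polyfuns_const]])
  from semialgebraic_imp[OF this assms] show ?thesis
    using semialgebraic_all[of "\<lambda>x z. (\<forall>v\<in>UNIV. \<bar>z v\<bar> \<le> 1) \<longrightarrow> S x z"]
    by (simp add: unit_box_def Ball_def)
qed

lemma semialgebraic_close:
  fixes w y :: "'m \<times> ('k \<Rightarrow>\<^sub>0 nat) \<Rightarrow> ('a \<Rightarrow> real) \<Rightarrow> real"
  assumes "\<And>a. w a \<in> polyfuns" "\<And>a. y a \<in> polyfuns" "t \<in> polyfuns"
  shows "semialgebraic (\<lambda>x. close (t x) (\<lambda>a. w a x) (\<lambda>a. y a x))"
proof -
  have sub: "(\<lambda>x :: 'a + 'k \<Rightarrow> real. f (\<lambda>a. x (Inl a))) \<in> polyfuns" if "f \<in> polyfuns" for f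
    by (rule polyfuns_subst[OF that polyfuns_var])
  have "semialgebraic (\<lambda>x. \<forall>z\<in>unit_box. \<forall>i\<in>UNIV. \<bar>val (\<lambda>a. w a x) i z - val (\<lambda>a. y a x) i z\<bar> \<le> t x)"
    by (intro semialgebraic_all_unit_box semialgebraic_ball finite semialgebraic_abs_le polyfuns_diff
        polyfuns_val sub assms polyfuns_var)
  then show ?thesis by (simp add: close_def)
qed

lemma semialgebraic_normal:
  fixes w :: "'m \<times> ('k \<Rightarrow>\<^sub>0 nat) \<Rightarrow> ('a \<Rightarrow> real) \<Rightarrow> real"
  assumes "\<And>a. w a \<in> polyfuns"
  shows "semialgebraic (\<lambda>x. normal (\<lambda>a. w a x))"
proof -
  have sub: "(\<lambda>x :: 'a + 'k \<Rightarrow> real. f (\<lambda>a. x (Inl a))) \<in> polyfuns" if "f \<in> polyfuns" for f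
    by (rule polyfuns_subst[OF that polyfuns_var])
  have "semialgebraic (\<lambda>x. \<forall>z\<in>unit_box. \<forall>i\<in>UNIV. \<bar>val (\<lambda>a. w a x) i z\<bar> \<le> 1)"
    by (intro semialgebraic_all_unit_box semialgebraic_ball finite semialgebraic_abs_le
        polyfuns_val sub assms polyfuns_var polyfuns_const)
  then show ?thesis by (simp add: normal_def)
qed

lemma semialgebraic_det_poly_le:
  fixes w :: "'m \<times> ('k \<Rightarrow>\<^sub>0 nat) \<Rightarrow> ('a \<Rightarrow> real) \<Rightarrow> real"
  assumes "\<And>a. w a \<in> polyfuns" "t \<in> polyfuns"
  shows "semialgebraic (\<lambda>x. \<forall>z\<in>unit_box. \<bar>det_poly (\<lambda>a. w a x) z\<bar> \<le> t x)"
proof -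
  have sub: "(\<lambda>x :: 'a + 'k \<Rightarrow> real. f (\<lambda>a. x (Inl a))) \<in> polyfuns" if "f \<in> polyfuns" for f
    by (rule polyfuns_subst[OF that polyfuns_var])
  show ?thesis
    by (intro semialgebraic_all_unit_box semialgebraic_abs_le polyfuns_det_poly sub assms polyfuns_var)
qed

text \<open>The two truth values index the two free variables, \<open>True\<close> for the distance
  and \<open>False\<close> for the bound on the determinant.\<close>

lemma semialgebraic_far: "semialgebraic (\<lambda>x. far (x True) (x False))"
  unfolding far_def degenerate_def
  by (intro semialgebraic_bex finite_idx semialgebraic_conj semialgebraic_normal semialgebraic_det_poly_le
      semialgebraic_ball_coords semialgebraic_imp semialgebraic_not semialgebraic_close
      polyfuns_var polyfuns_const)

lemma val_coeff_bounded: "\<exists>W. \<forall>w. normal w \<longrightarrow> (\<forall>a\<in>idx. \<bar>w a\<bar> \<le> W)"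
proof -
  obtain W where W: "\<And>c. \<forall>z\<in>unit_box. \<bar>poly_val d c z\<bar> \<le> 1 \<Longrightarrow>
    \<forall>e\<in>exponents d. \<bar>c (e :: 'k \<Rightarrow>\<^sub>0 nat)\<bar> \<le> W"
    using coeff_bounded_by_values by blast
  have "\<bar>w a\<bar> \<le> W" if w: "normal w" and a: "a \<in> idx" for w a
  proof -
    obtain i e where ie: "a = (i, e)" "e \<in> exponents d" using a by (auto simp: idx_def)
    have "\<forall>z\<in>unit_box. \<bar>poly_val d (\<lambda>e. w (i, e)) z\<bar> \<le> 1"
      using w by (simp add: normal_def val_def)
    from W[OF this] show ?thesis using ie by simp
  qed
  then show ?thesis by blast
qed

lemma close_if_coeffs_close:
  assumes "(\<Sum>a\<in>idx. \<bar>w a - y a\<bar>) \<le> t"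
  shows "close t w y"
  unfolding close_def
proof (intro ballI allI)
  fix z i assume z: "z \<in> (unit_box :: ('k \<Rightarrow> real) set)"
  have "\<bar>val w i z - val y i z\<bar> \<le> (\<Sum>e\<in>exponents d. \<bar>w (i, e) - y (i, e)\<bar>)"
    unfolding val_def poly_val_diff[symmetric] by (rule abs_poly_val_le[OF z])
  also have "\<dots> = (\<Sum>a\<in>Pair i ` exponents d. \<bar>w a - y a\<bar>)"
    by (subst sum.reindex) (auto simp: inj_on_def)
  also have "\<dots> \<le> (\<Sum>a\<in>idx. \<bar>w a - y a\<bar>)"
    by (rule sum_mono2[OF finite_idx]) (auto simp: idx_def)
  finally show "\<bar>val w i z - val y i z\<bar> \<le> t" using assms by simp
qed

lemma not_far:
  assumes "0 < t"
  shows "\<exists>s0>0. \<forall>s. 0 < s \<longrightarrow> s < s0 \<longrightarrow> \<not> far t s"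
proof (rule ccontr)
  assume "\<not> ?thesis"
  then have "\<exists>s. 0 < s \<and> s < inverse (real (Suc n)) \<and> far t s" for n
    by (metis inverse_positive_iff_positive of_nat_0_less_iff zero_less_Suc)
  then have "\<exists>w\<in>coords idx. normal w \<and> (\<forall>z\<in>unit_box. \<bar>det_poly w z\<bar> \<le> inverse (real (Suc n))) \<and>
     (\<forall>y\<in>coords idx. degenerate y \<longrightarrow> \<not> close t w y)" for n
    unfolding far_def by (meson less_imp_le order_trans)
  then obtain w where w: "\<And>n. w n \<in> coords idx" "\<And>n. normal (w n)"
    "\<And>n z. z \<in> unit_box \<Longrightarrow> \<bar>det_poly (w n) z\<bar> \<le> inverse (real (Suc n))"
    "\<And>n y. y \<in> coords idx \<Longrightarrow> degenerate y \<Longrightarrow> \<not> close t (w n) y"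
    by metis
  obtain W where W: "\<And>w a. normal w \<Longrightarrow> a \<in> idx \<Longrightarrow> \<bar>w a\<bar> \<le> W" using val_coeff_bounded by blast
  obtain r l0 where r: "strict_mono r" "\<forall>b\<in>idx. (\<lambda>n. w (r n) b) \<longlonglongrightarrow> l0 b"
    using convergent_subseq_finite[OF finite_idx, of w W] W[OF w(2)] by blast
  \<comment> \<open>The subsequence is only controlled on \<open>idx\<close>; elsewhere all terms
    vanish, and 0 is the limit.\<close>
  define l where "l b = (if b \<in> idx then l0 b else 0)" for b
  have l: "l \<in> coords idx" by (simp add: l_def coords_def)
  have lim: "(\<lambda>n. w (r n) b) \<longlonglongrightarrow> l b" for b
  proof (cases "b \<in> idx")
    case False
    then have "w n b = 0" for n using w(1)[of n] unfolding coords_def by blast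
    then show ?thesis using False by (simp add: l_def)
  qed (use r(2) in \<open>simp add: l_def\<close>)
  have "\<bar>val l i z\<bar> \<le> 1" if z: "z \<in> unit_box" for i z
  proof (rule LIMSEQ_le_const2)
    show "(\<lambda>n. \<bar>val (w (r n)) i z\<bar>) \<longlonglongrightarrow> \<bar>val l i z\<bar>"
      by (intro tendsto_rabs polyfuns_tendsto[of "\<lambda>w. val w i z", OF _ lim]
          polyfuns_val[of "\<lambda>a x. x a" "\<lambda>v _. z v"] polyfuns_var polyfuns_const)
    show "\<exists>N. \<forall>n\<ge>N. \<bar>val (w (r n)) i z\<bar> \<le> 1" using w(2) z by (auto simp: normal_def)
  qed
  moreover have "\<bar>det_poly l z\<bar> \<le> 0" if z: "z \<in> unit_box" for z
  proof (rule LIMSEQ_le)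
    show "(\<lambda>n. \<bar>det_poly (w (r n)) z\<bar>) \<longlonglongrightarrow> \<bar>det_poly l z\<bar>"
      by (intro tendsto_rabs polyfuns_tendsto[of "\<lambda>w. det_poly w z", OF _ lim]
          polyfuns_det_poly[of "\<lambda>a x. x a" "\<lambda>v _. z v"] polyfuns_var polyfuns_const)
    show "(\<lambda>n. inverse (real (Suc (r n)))) \<longlonglongrightarrow> 0"
      using LIMSEQ_subseq_LIMSEQ[OF LIMSEQ_inverse_real_of_nat r(1)] by (simp add: o_def)
    show "\<exists>N. \<forall>n\<ge>N. \<bar>det_poly (w (r n)) z\<bar> \<le> inverse (real (Suc (r n)))" using w(3)[OF z] by blast
  qed
  ultimately have deg: "degenerate l" by (simp add: degenerate_def normal_def)
  have "(\<lambda>n. \<Sum>a\<in>idx. \<bar>w (r n) a - l a\<bar>) \<longlonglongrightarrow> (\<Sum>a\<in>idx. \<bar>l a - l a\<bar>)"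
    by (intro tendsto_sum tendsto_rabs tendsto_diff lim tendsto_const)
  then have "eventually (\<lambda>n. (\<Sum>a\<in>idx. \<bar>w (r n) a - l a\<bar>) < t) sequentially"
    using assms by (intro order_tendstoD) auto
  then obtain n where "(\<Sum>a\<in>idx. \<bar>w (r n) a - l a\<bar>) < t" by (auto simp: eventually_sequentially)
  then have "close t (w (r n)) l" by (intro close_if_coeffs_close) simp
  then show False using w(4)[OF l deg] by blast
qed

text \<open>For small \<sigma> the distance t is chosen with \<open>t ^ Suc l\<close> proportional
  to \<sigma>, which puts the pair inside the region free of \<open>far\<close>. For the remaining
  \<sigma> the right-hand side is at least 2 and \<open>y0\<close> serves as approximation.\<close>

theorem lojasiewicz_degenerate:
  assumes y0: "y0 \<in> coords idx" "degenerate y0"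
  shows "\<exists>C\<ge>1. \<exists>\<beta>. 0 < \<beta> \<and> \<beta> \<le> 1 \<and> (\<forall>w \<sigma>. w \<in> coords idx \<longrightarrow> normal w \<longrightarrow> 0 < \<sigma> \<longrightarrow> \<sigma> \<le> 1 \<longrightarrow>
    (\<forall>z\<in>unit_box. \<bar>det_poly w z\<bar> \<le> \<sigma>) \<longrightarrow> (\<exists>y\<in>coords idx. degenerate y \<and> close (C * \<sigma> powr \<beta>) w y))"
proof -
  have "\<exists>c>0. \<exists>l. \<exists>t0>0. \<forall>t s. 0 < t \<longrightarrow> t < t0 \<longrightarrow> 0 < s \<longrightarrow> s < c * t ^ l \<longrightarrow> \<not> far t s"
    using semialgebraic_growth[OF semialgebraic_far, of True False "\<lambda>_. 0"] not_far by simp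
  then obtain c l t0 where c: "c > 0" "t0 > 0"
    "\<And>t s. 0 < t \<Longrightarrow> t < t0 \<Longrightarrow> 0 < s \<Longrightarrow> s < c * t ^ l \<Longrightarrow> \<not> far t s" by blast
  \<comment> \<open>The exponent \<open>Suc l\<close> is used since \<open>l\<close> may be 0 and
    \<beta> must not exceed 1. The factor 2 in \<open>A\<close> makes \<open>c * t ^ Suc l\<close>
    equal to 2 \<sigma>, hence strictly larger than \<sigma>.\<close>
  define \<beta> where "\<beta> = 1 / real (Suc l)"
  define A where "A = (2 / c) powr \<beta>"
  define t1 where "t1 = min 1 t0"
  \<comment> \<open>The factor \<open>2 / t1\<close> raises the bound to at least 2 when
    \<open>t\<close> is not below \<open>t1\<close>.\<close>
  define C where "C = max 1 (A * max 1 (2 / t1))"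
  have \<beta>: "0 < \<beta>" "\<beta> \<le> 1" by (auto simp: \<beta>_def)
  have A: "A > 0" using c(1) by (simp add: A_def)
  have t1: "t1 > 0" "t1 \<le> 1" "t1 \<le> t0" using c(2) by (auto simp: t1_def)
  have mono: "close t' w y" if "close t w y" "t \<le> t'" for t t' w y
    using that unfolding close_def by (meson order_trans)
  have "\<exists>y\<in>coords idx. degenerate y \<and> close (C * \<sigma> powr \<beta>) w y"
    if w: "w \<in> coords idx" "normal w" "\<forall>z\<in>unit_box. \<bar>det_poly w z\<bar> \<le> \<sigma>" and \<sigma>: "0 < \<sigma>" "\<sigma> \<le> 1" for w \<sigma>
  proof -
    define t where "t = A * \<sigma> powr \<beta>"
    have t: "t > 0" using A \<sigma> by (simp add: t_def)
    have tp: "t ^ Suc l = 2 / c * \<sigma>"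
    proof -
      have "t = (2 / c * \<sigma>) powr \<beta>" using c(1) \<sigma> unfolding t_def A_def by (subst powr_mult) simp_all
      then have "t ^ Suc l = ((2 / c * \<sigma>) powr \<beta>) powr real (Suc l)"
        using t by (simp only: powr_realpow)
      also have "\<dots> = 2 / c * \<sigma>" using c(1) \<sigma> by (simp add: powr_powr \<beta>_def del: of_nat_Suc)
      finally show ?thesis .
    qed
    have tC: "t \<le> C * \<sigma> powr \<beta>"
    proof -
      have "A * 1 \<le> A * max 1 (2 / t1)" using A by (intro mult_left_mono) auto
      then have "A \<le> C" by (simp add: C_def)
      then show ?thesis by (simp add: t_def mult_right_mono)
    qed
    show ?thesis
    proof (cases "t < t1")
      case True
      have "t ^ Suc l \<le> t ^ l" using t True t1 by (intro power_decreasing) auto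
      then have "c * t ^ Suc l \<le> c * t ^ l" using c(1) by (intro mult_left_mono) auto
      moreover have "c * t ^ Suc l = 2 * \<sigma>" unfolding tp using c(1) by simp
      ultimately have "\<sigma> < c * t ^ l" using \<sigma> by linarith
      then have "\<not> far t \<sigma>" using c(3)[of t \<sigma>] t True t1 \<sigma> by auto
      then obtain y where "y \<in> coords idx" "degenerate y" "close t w y"
        using w unfolding far_def by blast
      then show ?thesis using mono[OF _ tC] by blast
    next
      case False
      have "2 \<le> 2 / t1 * t" using False t1(1) by (simp add: field_simps)
      also have "\<dots> = A * (2 / t1) * \<sigma> powr \<beta>" by (simp add: t_def)
      also have "\<dots> \<le> C * \<sigma> powr \<beta>"
      proof (rule mult_right_mono)
        have "A * (2 / t1) \<le> A * max 1 (2 / t1)" using A by (intro mult_left_mono) auto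
        then show "A * (2 / t1) \<le> C" by (simp add: C_def)
      qed simp
      finally have "2 \<le> C * \<sigma> powr \<beta>" .
      moreover have "close 2 w y0"
        unfolding close_def
      proof (intro ballI allI)
        fix z i assume "z \<in> (unit_box :: ('k \<Rightarrow> real) set)"
        then have "\<bar>val w i z\<bar> \<le> 1" "\<bar>val y0 i z\<bar> \<le> 1"
          using w(2) y0(2) by (auto simp: normal_def degenerate_def)
        then show "\<bar>val w i z - val y0 i z\<bar> \<le> 2" by simp
      qed
      ultimately show ?thesis using y0 mono by blast
    qed
  qed
  then show ?thesis using \<beta> by (intro exI[of _ C] conjI exI[of _ \<beta>]) (auto simp: C_def)
qed

end

section \<open>Formal polynomials as functions on the cube\<close>

lemma unit_box_iff_cube: "(\<lambda>i. x $ i) \<in> unit_box \<longleftrightarrow> (x :: real ^ 'k::finite) \<in> cube"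
  by (auto simp: unit_box_def cube_def mem_box_cart abs_le_iff minus_le_iff)

lemma mpoly_fun_eq_poly_val:
  assumes "p \<in> polys0 d"
  shows "mpoly_fun p x = poly_val d (Poly_Mapping.lookup p) (\<lambda>i. x $ i)"
proof -
  have pp: "(\<Prod>v\<in>Poly_Mapping.keys e. x $ v ^ Poly_Mapping.lookup e v) = power_product e (\<lambda>i. x $ i)"
    for e :: "'a \<Rightarrow>\<^sub>0 nat"
    unfolding power_product_def by (rule prod.mono_neutral_left) (auto simp: in_keys_iff)
  show ?thesis
    unfolding mpoly_fun_def mpoly_eval_def poly_val_def pp
    using assms by (intro sum.mono_neutral_left finite_exponents)
      (auto simp: polys0_def exponents_def in_keys_iff)
qed

lemma real_polynomial_function_mpoly_fun: "real_polynomial_function (mpoly_fun p)"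
proof -
  have "real_polynomial_function (\<lambda>x. x $ v)" for v :: 'a
    by (rule real_polynomial_function.intros(1)) (rule bounded_linear_vec_nth)
  then show ?thesis
    unfolding mpoly_fun_def mpoly_eval_def
    by (intro real_polynomial_function_sum real_polynomial_function_prod real_polynomial_function_power
        real_polynomial_function.intros(4) real_polynomial_function.intros(2)) auto
qed

lemma real_polynomial_function_gradient:
  fixes f :: "real ^ 'k::finite \<Rightarrow> real"
  assumes "real_polynomial_function f"
  shows "\<exists>g. (\<forall>i. real_polynomial_function (g i)) \<and>
    (\<forall>x. (f has_derivative (\<lambda>h. \<Sum>i\<in>UNIV. g i x * h $ i)) (at x))"
  using assms
proof induction
  case (linear f)
  have "f h = (\<Sum>i\<in>UNIV. f (axis i 1) * h $ i)" for h
  proof -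
    have "f h = f (\<Sum>i\<in>UNIV. h $ i *\<^sub>R axis i 1)" by (simp add: basis_expansion flip: scalar_mult_eq_scaleR)
    also have "\<dots> = (\<Sum>i\<in>UNIV. f (axis i 1) * h $ i)"
      using linear by (simp add: linear_sum linear_cmul bounded_linear.linear mult.commute)
    finally show ?thesis .
  qed
  then have "f = (\<lambda>h. \<Sum>i\<in>UNIV. f (axis i 1) * h $ i)" by blast
  moreover have "(f has_derivative f) (at x)" for x
    using linear by (rule bounded_linear_imp_has_derivative)
  ultimately have "(f has_derivative (\<lambda>h. \<Sum>i\<in>UNIV. f (axis i 1) * h $ i)) (at x)" for x by metis
  then show ?case
    by (intro exI[of _ "\<lambda>i x. f (axis i 1)"]) (simp add: real_polynomial_function.intros(2))
next
  case (const c)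
  show ?case
    by (intro exI[of _ "\<lambda>i x. 0"]) (simp add: real_polynomial_function.intros(2))
next
  case (add f g)
  then obtain f' g' where "\<forall>i. real_polynomial_function (f' i)" "\<forall>i. real_polynomial_function (g' i)"
    "\<And>x. (f has_derivative (\<lambda>h. \<Sum>i\<in>UNIV. f' i x * h $ i)) (at x)"
    "\<And>x. (g has_derivative (\<lambda>h. \<Sum>i\<in>UNIV. g' i x * h $ i)) (at x)" by blast
  then show ?case
    by (intro exI[of _ "\<lambda>i x. f' i x + g' i x"] conjI allI real_polynomial_function.intros(3))
      (auto intro!: derivative_eq_intros simp: sum.distrib algebra_simps)
next
  case (mult f g)
  then obtain f' g' where fg: "\<forall>i. real_polynomial_function (f' i)" "\<forall>i. real_polynomial_function (g' i)"
    "\<And>x. (f has_derivative (\<lambda>h. \<Sum>i\<in>UNIV. f' i x * h $ i)) (at x)"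
    "\<And>x. (g has_derivative (\<lambda>h. \<Sum>i\<in>UNIV. g' i x * h $ i)) (at x)" by blast
  have "((\<lambda>x. f x * g x) has_derivative (\<lambda>h. \<Sum>i\<in>UNIV. (f x * g' i x + f' i x * g x) * h $ i)) (at x)" for x
    using has_derivative_mult[OF fg(3,4)]
    by (rule has_derivative_eq_rhs) (simp add: sum.distrib sum_distrib_left sum_distrib_right algebra_simps)
  then show ?case
    using fg(1,2) mult.hyps
    by (intro exI[of _ "\<lambda>i x. f x * g' i x + f' i x * g x"] conjI allI
        real_polynomial_function.intros(3) real_polynomial_function.intros(4)) auto
qed

text \<open>Partial derivatives of polynomial functions are again polynomial functions, so a chosen
  gradient can be iterated along any list of directions.\<close>

lemma smooth_on_cube_real_polynomial_function:
  fixes f :: "real ^ 'k::finite \<Rightarrow> real"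
  assumes "real_polynomial_function f"
  shows "smooth_on_cube f"
proof -
  have "\<forall>f. \<exists>g. real_polynomial_function f \<longrightarrow> (\<forall>i. real_polynomial_function (g i)) \<and>
    (\<forall>x. (f has_derivative (\<lambda>h. \<Sum>i\<in>UNIV. g i x * h $ i)) (at x))"
    for f :: "real ^ 'k \<Rightarrow> real"
    using real_polynomial_function_gradient by blast
  from choice[OF this] obtain G where G: "\<And>f :: real ^ 'k \<Rightarrow> real. real_polynomial_function f \<Longrightarrow>
    (\<forall>i. real_polynomial_function (G f i)) \<and>
    (\<forall>x. (f has_derivative (\<lambda>h. \<Sum>i\<in>UNIV. G f i x * h $ i)) (at x))"
    by blast
  define F where "F is = foldr (\<lambda>i f. G f i) is f" for "is"
  have "real_polynomial_function (F is)" for "is"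
    by (induction "is") (use assms G in \<open>simp_all add: F_def\<close>)
  moreover have "F (i # is) = G (F is) i" for i "is" by (simp add: F_def)
  ultimately show ?thesis
    unfolding smooth_on_cube_def using G
    by (intro exI[of _ F]) (simp add: F_def has_derivative_at_withinI)
qed

lemma continuous_on_mpoly_fun: "continuous_on S (mpoly_fun p)"
  by (intro continuous_at_imp_continuous_on ballI continuous_real_polymonial_function
      real_polynomial_function_mpoly_fun)

text \<open>A real supremum controls the values only of a set bounded above, which compactness of
  the cube guarantees. Normalisation thereby becomes a pointwise condition.\<close>

lemma polys_iff:
  "p \<in> polys d \<longleftrightarrow> p \<in> polys0 d \<and> (\<forall>x\<in>cube. \<bar>mpoly_fun p x\<bar> \<le> 1)"
proof -
  have "compact ((\<lambda>x. \<bar>mpoly_fun p x\<bar>) ` cube)"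
    unfolding cube_def by (intro compact_continuous_image continuous_intros continuous_on_mpoly_fun compact_cbox)
  then have bdd: "bdd_above ((\<lambda>x. \<bar>mpoly_fun p x\<bar>) ` cube)"
    by (intro bounded_imp_bdd_above compact_imp_bounded)
  have "(0 :: real ^ 'a) \<in> cube" by (simp add: cube_def mem_box_cart)
  then show ?thesis unfolding polys_def using cSUP_le_iff[OF _ bdd, of 1] by auto
qed

text \<open>All factors have absolute value at most 1, so differences of products and of powers add
  up without amplification, and the exponents sum to at most \<open>d\<close>.\<close>

lemma power_product_lipschitz:
  assumes "e \<in> exponents d" "z \<in> unit_box" "z' \<in> unit_box" "\<And>v. \<bar>z v - z' v\<bar> \<le> \<delta>"
  shows "\<bar>power_product e z - power_product e z'\<bar> \<le> real d * \<delta>"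
proof -
  have \<delta>: "0 \<le> \<delta>" using assms(4) abs_ge_zero order_trans by blast
  have z: "\<bar>z v\<bar> \<le> 1" "\<bar>z' v\<bar> \<le> 1" for v using assms(2,3) by (auto simp: unit_box_def)
  have "\<bar>power_product e z - power_product e z'\<bar> \<le>
    (\<Sum>v\<in>UNIV. \<bar>z v ^ Poly_Mapping.lookup e v - z' v ^ Poly_Mapping.lookup e v\<bar>)"
    unfolding power_product_def real_norm_def[symmetric]
    by (rule norm_prod_diff) (auto simp: power_abs z intro: power_le_one)
  also have "\<dots> \<le> (\<Sum>v\<in>UNIV. real (Poly_Mapping.lookup e v) * \<delta>)"
  proof (rule sum_mono)
    fix v
    have "\<bar>z v ^ Poly_Mapping.lookup e v - z' v ^ Poly_Mapping.lookup e v\<bar>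
      \<le> real (Poly_Mapping.lookup e v) * \<bar>z v - z' v\<bar>"
      unfolding real_norm_def[symmetric] by (rule norm_power_diff) (simp_all add: z)
    also have "\<dots> \<le> real (Poly_Mapping.lookup e v) * \<delta>"
      using assms(4) by (intro mult_left_mono) auto
    finally show "\<bar>z v ^ Poly_Mapping.lookup e v - z' v ^ Poly_Mapping.lookup e v\<bar> \<le> \<dots>" .
  qed
  also have "\<dots> = real (\<Sum>v\<in>UNIV. Poly_Mapping.lookup e v) * \<delta>" by (simp add: sum_distrib_right)
  also have "\<dots> \<le> real d * \<delta>"
    using assms(1) \<delta> by (intro mult_right_mono) (auto simp: exponents_def simp del: of_nat_sum)
  finally show ?thesis .
qed

lemma poly_val_lipschitz:
  assumes "z \<in> unit_box" "z' \<in> unit_box" "\<And>v. \<bar>z v - z' v\<bar> \<le> \<delta>"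
  shows "\<bar>poly_val d c z - poly_val d c z'\<bar> \<le> (\<Sum>e\<in>exponents d. \<bar>c e\<bar>) * (real d * \<delta>)"
proof -
  have "\<bar>poly_val d c z - poly_val d c z'\<bar> = \<bar>\<Sum>e\<in>exponents d. c e * (power_product e z - power_product e z')\<bar>"
    by (simp add: poly_val_def sum_subtractf right_diff_distrib)
  also have "\<dots> \<le> (\<Sum>e\<in>exponents d. \<bar>c e * (power_product e z - power_product e z')\<bar>)" by (rule sum_abs)
  also have "\<dots> \<le> (\<Sum>e\<in>exponents d. \<bar>c e\<bar> * (real d * \<delta>))"
    unfolding abs_mult using power_product_lipschitz[OF _ assms] by (intro sum_mono mult_left_mono) auto
  also have "\<dots> = (\<Sum>e\<in>exponents d. \<bar>c e\<bar>) * (real d * \<delta>)" by (simp add: sum_distrib_right)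
  finally show ?thesis .
qed

section \<open>Tuples and their coefficient vectors\<close>

text \<open>The cut-off at \<open>exponents d\<close> gives finite support, so every
  \<open>w\<close> yields polynomials of degree at most \<open>d\<close>.\<close>

definition tuple_of :: "nat \<Rightarrow> ('m \<times> ('k::finite \<Rightarrow>\<^sub>0 nat) \<Rightarrow> real) \<Rightarrow> 'm \<Rightarrow> 'k real_mpoly" where
  "tuple_of d w i = Abs_poly_mapping (\<lambda>e. if e \<in> exponents d then w (i, e) else 0)"

lemma lookup_tuple_of:
  "Poly_Mapping.lookup (tuple_of d w i) e = (if e \<in> exponents d then w (i, e) else 0)"
proof -
  have "finite {e. (if e \<in> exponents d then w (i, e) else 0) \<noteq> 0}"
    by (rule finite_subset[OF _ finite_exponents]) (auto split: if_splits)
  then show ?thesis unfolding tuple_of_def by (simp add: lookup_Abs_poly_mapping)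
qed

lemma tuple_of_in_polys0: "tuple_of d w i \<in> polys0 d"
  by (auto simp: polys0_def in_keys_iff lookup_tuple_of exponents_def split: if_splits)

lemma tuple_of_lookup:
  assumes "\<And>i. \<phi> i \<in> polys0 d"
  shows "tuple_of d (\<lambda>(i, e). Poly_Mapping.lookup (\<phi> i) e) = \<phi>"
proof (rule ext, rule poly_mapping_eqI)
  fix i e
  show "Poly_Mapping.lookup (tuple_of d (\<lambda>(i, e). Poly_Mapping.lookup (\<phi> i) e) i) e = Poly_Mapping.lookup (\<phi> i) e"
    using assms[of i] by (auto simp: lookup_tuple_of polys0_def exponents_def in_keys_iff)
qed

text \<open>Variables of \<open>q\<close> beyond degree \<open>d\<close> receive the constant 0,
  because \<open>tuple_of\<close> drops them. So the composition is polynomial in all of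
  \<open>w\<close>, as the locale requires.\<close>

lemma polyfuns_coeff:
  assumes "polynomial_extension d D H E"
  shows "(\<lambda>w. Poly_Mapping.lookup (E (tuple_of d w)) e) \<in> polyfuns"
proof -
  obtain q where q: "\<And>\<phi>. \<forall>i. \<phi> i \<in> polys0 d \<Longrightarrow>
    Poly_Mapping.lookup (E \<phi>) e = mpoly_eval q (\<lambda>(i, e'). Poly_Mapping.lookup (\<phi> i) e')"
    using assms unfolding polynomial_extension_def by meson
  have "(\<lambda>w. (\<lambda>(i, e'). Poly_Mapping.lookup (tuple_of d w i) e') v) \<in> polyfuns" for v
    by (cases v, cases "snd v \<in> exponents d") (simp_all add: lookup_tuple_of polyfuns_const polyfuns_var)
  then have "(\<lambda>w. mpoly_eval q (\<lambda>(i, e'). Poly_Mapping.lookup (tuple_of d w i) e')) \<in> polyfuns"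
    unfolding mpoly_eval_def by (intro polyfuns_sum polyfuns_mult polyfuns_prod polyfuns_power polyfuns_const)
  then show ?thesis by (simp add: q tuple_of_in_polys0)
qed

text \<open>The hypothesis \<open>zero\<close> is condition (2) at \<sigma> = 1 without its
  estimate, so the conclusion implies it. It excludes maps such as the constant 1/2, which satisfies
  the scaling hypothesis vacuously but admits no degenerate graph.\<close>

theorem proposition3p15:
  fixes d D :: nat
    and \<M> :: "((real ^ 'k::finite) \<times> (real ^ 'm::finite)) set set"
    and \<RR> :: "(real ^ 'k) set set set"
    and \<R> :: "(real ^ 'k) set set"
    and H :: "((real ^ 'k) \<times> (real ^ 'm)) set \<Rightarrow> 'k real_mpoly"
    and E :: "('m \<Rightarrow> 'k real_mpoly) \<Rightarrow> 'k real_mpoly"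
  assumes M: "\<M> = poly_graphs d"
    and R: "\<RR> = {\<R>}" "\<R> \<subseteq> parallelograms0"
    and H: "\<forall>M\<in>\<M>. H M \<in> polys0 D"
    and E: "polynomial_extension d D H E"
    and scaling: "\<forall>\<phi> c. (\<forall>i. \<phi> i \<in> polys d) \<longrightarrow>
           (\<forall>x\<in>cube. mpoly_fun (H (graph_of (mpoly_map \<phi>))) x = 0) \<longrightarrow>
           (\<forall>x\<in>cube. mpoly_fun (E (mpoly_scale c \<phi>)) x = 0)"
    and zero: "(\<exists>M\<in>\<M>. \<forall>x\<in>cube. \<bar>mpoly_fun (H M) x\<bar> \<le> 1) \<longrightarrow>
           (\<exists>M\<in>\<M>. \<forall>x\<in>cube. mpoly_fun (H M) x = 0)"
  shows "\<exists>C C' \<beta>. degeneracy_determinant \<M> (\<lambda>M. mpoly_fun (H M)) C C' \<beta>"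
proof -
  have HE: "H (graph_of (mpoly_map \<phi>)) = E \<phi>" if "\<forall>i. \<phi> i \<in> polys d" for \<phi>
    using E that unfolding polynomial_extension_def by simp
  interpret poly_family d D "\<lambda>e (w :: 'm \<times> ('k \<Rightarrow>\<^sub>0 nat) \<Rightarrow> real). Poly_Mapping.lookup (E (tuple_of d w)) e"
    by unfold_locales (rule polyfuns_coeff[OF E])
  have E0: "E (tuple_of d w) \<in> polys0 D" for w
    using E unfolding polynomial_extension_def by (simp add: tuple_of_in_polys0)
  have det_poly: "mpoly_fun (E (tuple_of d w)) x = det_poly w (\<lambda>i. x $ i)" for w x
    unfolding det_poly_def by (rule mpoly_fun_eq_poly_val[OF E0])
  have val: "mpoly_fun (tuple_of d w i) x = val w i (\<lambda>i. x $ i)" if "w \<in> coords idx" for w i x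
  proof -
    have "poly_val d (Poly_Mapping.lookup (tuple_of d w i)) z = poly_val d (\<lambda>e. w (i, e)) z" for z
      unfolding poly_val_def by (rule sum.cong) (simp_all add: lookup_tuple_of)
    then show ?thesis unfolding val_def mpoly_fun_eq_poly_val[OF tuple_of_in_polys0] by simp
  qed
  have box: "(\<forall>z\<in>unit_box. P z) \<longleftrightarrow> (\<forall>x\<in>cube. P (\<lambda>i. x $ i))" for P :: "('k \<Rightarrow> real) \<Rightarrow> bool"
  proof
    assume *: "\<forall>x\<in>cube. P (\<lambda>i. x $ i)"
    show "\<forall>z\<in>unit_box. P z"
    proof
      fix z :: "'k \<Rightarrow> real" assume "z \<in> unit_box"
      then have "(\<chi> i. z i) \<in> cube" by (simp flip: unit_box_iff_cube)
      then show "P z" using * by (metis (no_types, lifting) ext vec_lambda_beta)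
    qed
  qed (simp add: unit_box_iff_cube)
  have normal: "normal w \<longleftrightarrow> (\<forall>i. tuple_of d w i \<in> polys d)" if "w \<in> coords idx" for w
    unfolding normal_def box polys_iff val[OF that] by (auto simp: tuple_of_in_polys0)
  have coords: "\<exists>w\<in>coords idx. normal w \<and> tuple_of d w = \<phi>" if \<phi>: "\<forall>i. \<phi> i \<in> polys d" for \<phi>
  proof
    let ?w = "\<lambda>(i, e). Poly_Mapping.lookup (\<phi> i) e"
    have p0: "\<phi> i \<in> polys0 d" for i using \<phi> by (simp add: polys_iff)
    then have "Poly_Mapping.lookup (\<phi> i) e = 0" if "e \<notin> exponents d" for i e
      using that by (force simp: polys0_def exponents_def in_keys_iff)
    then show w: "?w \<in> coords idx" by (auto simp: coords_def idx_def)
    show "normal ?w \<and> tuple_of d ?w = \<phi>"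
      using normal[OF w] tuple_of_lookup[of \<phi>, OF p0] \<phi> by simp
  qed
  have graphs: "\<exists>w\<in>coords idx. normal w \<and> M = graph_of (mpoly_map (tuple_of d w)) \<and> H M = E (tuple_of d w)"
    if M_in: "M \<in> \<M>" for M
  proof -
    obtain \<phi> where \<phi>: "\<forall>i. \<phi> i \<in> polys d" "M = graph_of (mpoly_map \<phi>)"
      using M_in unfolding M poly_graphs_def by blast
    then show ?thesis using coords[OF \<phi>(1)] HE[OF \<phi>(1)] by metis
  qed
  have graph_in: "graph_of (mpoly_map (tuple_of d w)) \<in> \<M>"
    "H (graph_of (mpoly_map (tuple_of d w))) = E (tuple_of d w)" if "w \<in> coords idx" "normal w" for w
    using normal[OF that(1)] that(2) HE[of "tuple_of d w"] unfolding M poly_graphs_def by auto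

  obtain W where W: "\<And>w a. normal w \<Longrightarrow> a \<in> idx \<Longrightarrow> \<bar>w a\<bar> \<le> W" using val_coeff_bounded by blast
  have "\<exists>B. \<forall>e. \<forall>w\<in>coords idx. normal w \<longrightarrow> \<bar>Poly_Mapping.lookup (E (tuple_of d w)) e\<bar> \<le> B e"
  proof -
    \<comment> \<open>\<open>polyfuns_bounded\<close> asks for one bound on all coordinates; the
      maximum with 0 includes the zero coordinates outside \<open>idx\<close>.\<close>
    have "\<forall>e. \<exists>B. \<forall>w. (\<forall>a. \<bar>w a\<bar> \<le> max W 0) \<longrightarrow> \<bar>Poly_Mapping.lookup (E (tuple_of d w)) e\<bar> \<le> B"
      using polyfuns_bounded[OF polyfuns_coeff[OF E]] by blast
    from choice[OF this] obtain B where B: "\<And>e w. (\<forall>a. \<bar>w a\<bar> \<le> max W 0) \<Longrightarrow>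
      \<bar>Poly_Mapping.lookup (E (tuple_of d w)) e\<bar> \<le> B e" by blast
    have "\<bar>w a\<bar> \<le> max W 0" if "w \<in> coords idx" "normal w" for w a
    proof (cases "a \<in> idx")
      case True
      then show ?thesis using W[OF that(2)] by (simp add: le_max_iff_disj)
    next
      case False
      then have "w a = 0" using that(1) unfolding coords_def by blast
      then show ?thesis by simp
    qed
    then show ?thesis using B by blast
  qed
  then obtain B where B: "\<And>e w. w \<in> coords idx \<Longrightarrow> normal w \<Longrightarrow>
    \<bar>Poly_Mapping.lookup (E (tuple_of d w)) e\<bar> \<le> B e" by blast
  define L where "L = (\<Sum>e\<in>exponents D. B e) * real D"
  have lip: "\<bar>mpoly_fun (H M) x - mpoly_fun (H M) y\<bar> \<le> L * norm (x - y)"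
    if "M \<in> \<M>" "x \<in> cube" "y \<in> cube" for M x y
  proof -
    obtain w where w: "w \<in> coords idx" "normal w" "H M = E (tuple_of d w)" using graphs[OF \<open>M \<in> \<M>\<close>] by blast
    have "\<bar>mpoly_fun (H M) x - mpoly_fun (H M) y\<bar> \<le>
      (\<Sum>e\<in>exponents D. \<bar>Poly_Mapping.lookup (E (tuple_of d w)) e\<bar>) * (real D * norm (x - y))"
      unfolding w(3) mpoly_fun_eq_poly_val[OF E0]
      using that component_le_norm_cart[of "x - y"]
      by (intro poly_val_lipschitz) (simp_all add: unit_box_iff_cube)
    also have "\<dots> \<le> (\<Sum>e\<in>exponents D. B e) * (real D * norm (x - y))"
      using B[OF w(1,2)] by (intro mult_right_mono sum_mono) auto
    finally show ?thesis by (simp add: L_def)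
  qed
  have smooth: "smooth_on_cube (mpoly_fun (H M))" for M
    by (rule smooth_on_cube_real_polynomial_function[OF real_polynomial_function_mpoly_fun])

  have "\<exists>C\<ge>1. \<exists>\<beta>. 0 < \<beta> \<and> \<beta> \<le> 1 \<and> (\<forall>w \<sigma>. w \<in> coords idx \<longrightarrow> normal w \<longrightarrow> 0 < \<sigma> \<longrightarrow> \<sigma> \<le> 1 \<longrightarrow>
    (\<forall>z\<in>unit_box. \<bar>det_poly w z\<bar> \<le> \<sigma>) \<longrightarrow> (\<exists>y\<in>coords idx. degenerate y \<and> close (C * \<sigma> powr \<beta>) w y))"
  \<comment> \<open>If no normalised tuple has determinant at most 1, condition (2) is vacuous
    because \<sigma> is at most 1. Otherwise \<open>zero\<close> provides the degenerate tuple
    \<open>y0\<close>.\<close>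
  proof (cases "\<exists>w\<in>coords idx. normal w \<and> (\<forall>z\<in>unit_box. \<bar>det_poly w z\<bar> \<le> 1)")
    case True
    then obtain w where "w \<in> coords idx" "normal w" "\<forall>z\<in>unit_box. \<bar>det_poly w z\<bar> \<le> 1" by blast
    then have "\<exists>M\<in>\<M>. \<forall>x\<in>cube. \<bar>mpoly_fun (H M) x\<bar> \<le> 1"
      using graph_in[of w] det_poly by (intro bexI[of _ "graph_of (mpoly_map (tuple_of d w))"]) (simp_all add: box)
    then obtain M0 where M0: "M0 \<in> \<M>" "\<forall>x\<in>cube. mpoly_fun (H M0) x = 0" using zero by blast
    obtain y0 where "y0 \<in> coords idx" "normal y0" "H M0 = E (tuple_of d y0)" using graphs[OF M0(1)] by blast
    then have "y0 \<in> coords idx" "degenerate y0"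
      using M0(2) by (simp_all add: degenerate_def box det_poly)
    then show ?thesis by (rule lojasiewicz_degenerate)
  next
    case False
    have "\<not> (\<forall>z\<in>unit_box. \<bar>det_poly w z\<bar> \<le> \<sigma>)" if "w \<in> coords idx" "normal w" "\<sigma> \<le> 1" for w \<sigma>
      using False that order_trans by blast
    then show ?thesis by (intro exI[of _ 1] conjI allI impI) (blast | simp)+
  qed
  then obtain C0 \<beta> where C0: "C0 \<ge> 1" "0 < \<beta>" "\<beta> \<le> 1"
    "\<And>w \<sigma>. w \<in> coords idx \<Longrightarrow> normal w \<Longrightarrow> 0 < \<sigma> \<Longrightarrow> \<sigma> \<le> 1 \<Longrightarrow> \<forall>z\<in>unit_box. \<bar>det_poly w z\<bar> \<le> \<sigma> \<Longrightarrow>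
      \<exists>y\<in>coords idx. degenerate y \<and> close (C0 * \<sigma> powr \<beta>) w y"
    by blast
  \<comment> \<open>The Euclidean norm is bounded by the sum of the \<open>CARD('m)\<close>
    componentwise distances; \<open>L\<close> is included so that the same constant serves the
    Lipschitz condition.\<close>
  define C where "C = max (real CARD('m) * C0) (max 1 L)"
  have approx: "\<exists>\<psi>. graph_of \<psi> \<in> \<M> \<and> (\<forall>x\<in>cube. mpoly_fun (H (graph_of \<psi>)) x = 0) \<and>
      Linf_norm_cube (\<lambda>x. \<phi> x - 1 *\<^sub>R \<psi> x) \<le> ereal (C * \<sigma> powr \<beta>)"
    if \<phi>: "graph_of \<phi> \<in> \<M>" and \<sigma>: "0 < \<sigma>" "\<sigma> \<le> 1"
      and small: "\<forall>x\<in>cube. \<bar>mpoly_fun (H (graph_of \<phi>)) x\<bar> \<le> \<sigma>" for \<phi> \<sigma>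
  proof -
    obtain w where w: "w \<in> coords idx" "normal w" "graph_of \<phi> = graph_of (mpoly_map (tuple_of d w))"
      "H (graph_of \<phi>) = E (tuple_of d w)"
      using graphs[OF \<phi>] by blast
    \<comment> \<open>Only the graph of \<phi> over the cube is given, so \<phi> may be arbitrary
      elsewhere. Measurability and norm estimates therefore pass through the polynomial map with
      which it agrees on the cube.\<close>
    have \<phi>w: "\<phi> x = mpoly_map (tuple_of d w) x" if "x \<in> cube" for x
      using w(3) that unfolding graph_of_def set_eq_iff by blast
    have "\<forall>z\<in>unit_box. \<bar>det_poly w z\<bar> \<le> \<sigma>" using small by (simp add: box w(4) det_poly)
    then obtain y where y: "y \<in> coords idx" "degenerate y" "close (C0 * \<sigma> powr \<beta>) w y"
      using C0(4) w(1,2) \<sigma> by blast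
    have ny: "normal y" using y(2) by (simp add: degenerate_def)
    define \<psi> where "\<psi> = mpoly_map (tuple_of d y)"
    have "graph_of \<psi> \<in> \<M>" unfolding \<psi>_def by (rule graph_in[OF y(1) ny])
    moreover have "\<forall>x\<in>cube. mpoly_fun (H (graph_of \<psi>)) x = 0"
      using y(2) unfolding \<psi>_def graph_in(2)[OF y(1) ny] det_poly by (simp add: degenerate_def box)
    moreover have "Linf_norm_cube (\<lambda>x. \<phi> x - 1 *\<^sub>R \<psi> x) \<le> ereal (C * \<sigma> powr \<beta>)"
      unfolding Linf_norm_cube_def
    proof (rule esssup_I)
      have "continuous_on cube (\<lambda>x. norm (mpoly_map (tuple_of d w) x - \<psi> x))"
        unfolding \<psi>_def mpoly_map_def
        by (intro continuous_intros continuous_on_mpoly_fun)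
      then have "(\<lambda>x. norm (mpoly_map (tuple_of d w) x - \<psi> x)) \<in> borel_measurable (lebesgue_on cube)"
        by (rule continuous_imp_measurable_on_sets_lebesgue) (simp add: cube_def)
      then have "(\<lambda>x. ereal (norm (mpoly_map (tuple_of d w) x - \<psi> x))) \<in> borel_measurable (lebesgue_on cube)"
        by simp
      then show "(\<lambda>x. ereal (norm (\<phi> x - 1 *\<^sub>R \<psi> x))) \<in> borel_measurable (lebesgue_on cube)"
        by (rule measurable_cong[THEN iffD1, rotated]) (simp add: space_restrict_space \<phi>w)
      show "AE x in lebesgue_on cube. ereal (norm (\<phi> x - 1 *\<^sub>R \<psi> x)) \<le> ereal (C * \<sigma> powr \<beta>)"
      proof (rule AE_I2)
        fix x :: "real ^ 'k" assume "x \<in> space (lebesgue_on cube)"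
        then have x: "x \<in> cube" by (simp add: space_restrict_space)
        have "norm (\<phi> x - \<psi> x) \<le> (\<Sum>i\<in>UNIV. \<bar>(\<phi> x - \<psi> x) $ i\<bar>)" by (rule norm_le_l1_cart)
        also have "\<dots> \<le> (\<Sum>i\<in>(UNIV :: 'm set). C0 * \<sigma> powr \<beta>)"
        proof (rule sum_mono)
          fix i
          have "(\<phi> x - \<psi> x) $ i = val w i (\<lambda>i. x $ i) - val y i (\<lambda>i. x $ i)"
            by (simp add: \<phi>w[OF x] \<psi>_def mpoly_map_def val w(1) y(1))
          then show "\<bar>(\<phi> x - \<psi> x) $ i\<bar> \<le> C0 * \<sigma> powr \<beta>"
            using y(3) x unit_box_iff_cube[of x] by (simp add: close_def)
        qed
        also have "\<dots> = real CARD('m) * C0 * \<sigma> powr \<beta>" by simp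
        also have "\<dots> \<le> C * \<sigma> powr \<beta>" by (intro mult_right_mono) (simp_all add: C_def)
        finally show "ereal (norm (\<phi> x - 1 *\<^sub>R \<psi> x)) \<le> ereal (C * \<sigma> powr \<beta>)" by simp
      qed
    qed
    ultimately show ?thesis by blast
  qed
  have "degeneracy_determinant \<M> (\<lambda>M. mpoly_fun (H M)) C 1 \<beta>"
    unfolding degeneracy_determinant_def
  proof (intro conjI ballI allI impI)
    fix M and x y :: "real ^ 'k"
    assume "M \<in> \<M>" "x \<in> cube" "y \<in> cube"
    then have "\<bar>mpoly_fun (H M) x - mpoly_fun (H M) y\<bar> \<le> L * norm (x - y)" by (rule lip)
    also have "\<dots> \<le> C * norm (x - y)" by (intro mult_right_mono) (simp_all add: C_def)
    finally show "\<bar>mpoly_fun (H M) x - mpoly_fun (H M) y\<bar> \<le> C * norm (x - y)" .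
  qed (use C0 smooth approx in \<open>simp_all add: C_def\<close>)
  then show ?thesis by blast
qed

end
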